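(* Let $p$ be a prime. Then there is a positive diagonal ternary form $Q=\langle 1,q,p\rangle$ that is anisotropic precisely at $p$ and $\infty$, where $q=1$ or $q$ is a prime different from $p$.
   Context: For positive integers $a,b,c$, $\langle a,b,c\rangle$ denotes the quadratic form $ax^2+by^2+cz^2$. Let $\nu$ be a place of $\mathbb{Q}$ (a prime, or $\infty$, with $\mathbb{Q}_\infty=\mathbb{R}$). A form $Q(x,y,z)$ is isotropic at $\nu$ if $Q(x,y,z)=0$ for some $x,y,z\in\mathbb{Q}_\nu$, not all of them $0$; otherwise it is anisotropic at $\nu$. "Anisotropic precisely at $p$ and $\infty$" means anisotropic at the places $p$ and $\infty$ and isotropic at every other place. *)

theory Defs
  imports
    Complex_Main
    "HOL-Computational_Algebra.Primes"
    "HOL-Algebra.QuotRing"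
    "HOL-Algebra.Algebraic_Closure_Type"
begin

section \<open>The field of p-adic numbers\<close>

definition padic_val :: "nat \<Rightarrow> rat \<Rightarrow> int" where
  "padic_val p x =
     int (multiplicity (int p) (fst (quotient_of x))) -
     int (multiplicity (int p) (snd (quotient_of x)))"

definition padic_abs :: "nat \<Rightarrow> rat \<Rightarrow> real" where
  "padic_abs p x = (if x = 0 then 0 else real p powi (- padic_val p x))"

definition padic_Cauchy :: "nat \<Rightarrow> (nat \<Rightarrow> rat) \<Rightarrow> bool" where
  "padic_Cauchy p s \<longleftrightarrow>
     (\<forall>e>0. \<exists>N. \<forall>m\<ge>N. \<forall>n\<ge>N. padic_abs p (s m - s n) < e)"

definition padic_null :: "nat \<Rightarrow> (nat \<Rightarrow> rat) \<Rightarrow> bool" where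
  "padic_null p s \<longleftrightarrow> (\<lambda>n. padic_abs p (s n)) \<longlonglongrightarrow> 0"

definition padic_Cauchy_ring :: "nat \<Rightarrow> (nat \<Rightarrow> rat) ring" where
  "padic_Cauchy_ring p =
     \<lparr>carrier = {s. padic_Cauchy p s},
      monoid.mult = (\<lambda>s t n. s n * t n), one = (\<lambda>n. 1),
      zero = (\<lambda>n. 0), add = (\<lambda>s t n. s n + t n)\<rparr>"

text \<open>
  The completion of the rationals at \<open>p\<close>: Cauchy sequences modulo null sequences.
\<close>

definition Qp :: "nat \<Rightarrow> (nat \<Rightarrow> rat) set ring" where
  "Qp p = padic_Cauchy_ring p Quot {s. padic_null p s}"


context
  fixes p :: nat
  assumes p: "prime p"
begin

lemma prime_elem_int_p: "prime_elem (int p)"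
  using p by simp

lemma padic_val_Fract:
  assumes "a \<noteq> 0" "b \<noteq> 0"
  shows "padic_val p (Rat.Fract a b) = int (multiplicity (int p) a) - int (multiplicity (int p) b)"
proof -
  obtain c d where cd: "quotient_of (Rat.Fract a b) = (c, d)"
    by (cases "quotient_of (Rat.Fract a b)")
  have d: "d > 0" using cd quotient_of_denom_pos by blast
  have eq: "Rat.Fract c d = Rat.Fract a b" using cd quotient_of_eq by blast
  then have cross: "c * b = a * d" using d assms by (simp add: eq_rat)
  then have c: "c \<noteq> 0" using d assms by auto
  have "multiplicity (int p) c + multiplicity (int p) b
      = multiplicity (int p) a + multiplicity (int p) d"
    using cross c d assms prime_elem_multiplicity_mult_distrib[OF prime_elem_int_p]
    by (metis less_irrefl)
  then show ?thesis unfolding padic_val_def cd by simp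
qed

lemma padic_abs_nonneg [simp]: "padic_abs p x \<ge> 0"
  by (simp add: padic_abs_def)

lemma padic_abs_zero [simp]: "padic_abs p 0 = 0"
  by (simp add: padic_abs_def)

lemma padic_abs_eq_0_iff [simp]: "padic_abs p x = 0 \<longleftrightarrow> x = 0"
  using p by (auto simp: padic_abs_def)

lemma padic_abs_one [simp]: "padic_abs p 1 = 1"
  by (simp add: padic_abs_def padic_val_def)

lemma padic_abs_minus [simp]: "padic_abs p (- x) = padic_abs p x"
proof (cases "x = 0")
  case False
  obtain a b where x: "x = Rat.Fract a b" "b > 0" by (cases x) auto
  with False have "a \<noteq> 0" by (auto simp: rat_number_collapse)
  then have "padic_val p (- x) = padic_val p x"
    using x padic_val_Fract[of a b] padic_val_Fract[of "- a" b] by simp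
  then show ?thesis by (simp add: padic_abs_def)
qed simp

lemma padic_abs_mult [simp]: "padic_abs p (x * y) = padic_abs p x * padic_abs p y"
proof (cases "x = 0 \<or> y = 0")
  case False
  obtain a b c d where x: "x = Rat.Fract a b" "b > 0" and y: "y = Rat.Fract c d" "d > 0"
    by (cases x, cases y) auto
  with False have nz: "a \<noteq> 0" "c \<noteq> 0" by (auto simp: rat_number_collapse)
  have "padic_val p (x * y) = padic_val p x + padic_val p y"
    using x y nz prime_elem_multiplicity_mult_distrib[OF prime_elem_int_p]
    by (simp add: padic_val_Fract)
  moreover have "real p \<noteq> 0" using p by auto
  ultimately show ?thesis using False
    by (simp add: padic_abs_def power_int_diff power_int_minus power_int_add divide_inverse)
qed auto

lemma padic_abs_inverse: "padic_abs p (inverse x) = inverse (padic_abs p x)"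
proof (cases "x = 0")
  case False
  then have "padic_abs p (inverse x) * padic_abs p x = 1"
    by (metis left_inverse padic_abs_mult padic_abs_one)
  then show ?thesis by (metis inverse_unique mult.commute)
qed simp

lemma padic_abs_add_le: "padic_abs p (x + y) \<le> max (padic_abs p x) (padic_abs p y)"
proof (cases "x = 0 \<or> y = 0 \<or> x + y = 0")
  case False
  obtain a b c d where x: "x = Rat.Fract a b" "b > 0" and y: "y = Rat.Fract c d" "d > 0"
    by (cases x, cases y) auto
  with False have nz: "a \<noteq> 0" "c \<noteq> 0" by (auto simp: rat_number_collapse)
  define m where "m = multiplicity (int p)"
  have m_mult: "m (u * v) = m u + m v" if "u \<noteq> 0" "v \<noteq> 0" for u v
    unfolding m_def using that by (rule prime_elem_multiplicity_mult_distrib[OF prime_elem_int_p])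
  have sum: "x + y = Rat.Fract (a * d + c * b) (b * d)" using x y by simp
  have nz': "a * d + c * b \<noteq> 0"
    using sum False x y by (auto simp: rat_number_collapse)
  have "int p ^ min (m (a * d)) (m (c * b)) dvd a * d + c * b"
    unfolding m_def by (intro dvd_add multiplicity_dvd') simp_all
  then have "min (m (a * d)) (m (c * b)) \<le> m (a * d + c * b)"
    unfolding m_def using nz' p
    by (intro multiplicity_geI) (auto simp: prime_nat_iff)
  then have "padic_val p (x + y) \<ge> min (padic_val p x) (padic_val p y)"
    using x y nz nz' sum by (auto simp: padic_val_Fract m_mult simp flip: m_def split: if_splits)
  then have "- padic_val p (x + y) \<le> max (- padic_val p x) (- padic_val p y)"
    by linarith
  moreover have "1 \<le> real p" using p prime_ge_1_nat by auto
  ultimately show ?thesis using False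
    by (auto simp: padic_abs_def le_max_iff_disj intro: power_int_increasing)
qed (use padic_abs_nonneg in \<open>auto simp: le_max_iff_disj\<close>)

lemma padic_abs_add_le_sum: "padic_abs p (x + y) \<le> padic_abs p x + padic_abs p y"
  using padic_abs_add_le[of x y] padic_abs_nonneg[of x] padic_abs_nonneg[of y] by linarith

lemma padic_abs_diff_ge: "padic_abs p x - padic_abs p y \<le> padic_abs p (x - y)"
  using padic_abs_add_le_sum[of "x - y" y] by simp

lemma padic_Cauchy_const: "padic_Cauchy p (\<lambda>_. c)"
  by (simp add: padic_Cauchy_def)

lemma padic_Cauchy_minus: "padic_Cauchy p (\<lambda>n. - s n)" if "padic_Cauchy p s"
proof -
  have "padic_abs p (- s m - - s n) = padic_abs p (s m - s n)" for m n
    using padic_abs_minus[of "s m - s n"] by simp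
  then show ?thesis using that by (simp add: padic_Cauchy_def)
qed

lemma padic_Cauchy_add:
  assumes s: "padic_Cauchy p s" and t: "padic_Cauchy p t"
  shows "padic_Cauchy p (\<lambda>n. s n + t n)"
  unfolding padic_Cauchy_def
proof (intro allI impI)
  fix e :: real assume "e > 0"
  then obtain M N where M: "\<And>m n. m \<ge> M \<Longrightarrow> n \<ge> M \<Longrightarrow> padic_abs p (s m - s n) < e"
    and N: "\<And>m n. m \<ge> N \<Longrightarrow> n \<ge> N \<Longrightarrow> padic_abs p (t m - t n) < e"
    using s t unfolding padic_Cauchy_def by metis
  have "padic_abs p (s m + t m - (s n + t n)) < e" if "m \<ge> max M N" "n \<ge> max M N" for m n
    using padic_abs_add_le[of "s m - s n" "t m - t n"] M[of m n] N[of m n] that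
    by (simp add: algebra_simps)
  then show "\<exists>N. \<forall>m\<ge>N. \<forall>n\<ge>N. padic_abs p (s m + t m - (s n + t n)) < e" by blast
qed

lemma padic_Cauchy_bounded:
  assumes "padic_Cauchy p s"
  obtains B where "B > 0" "\<And>n. padic_abs p (s n) \<le> B"
proof -
  obtain N where N: "\<And>m n. m \<ge> N \<Longrightarrow> n \<ge> N \<Longrightarrow> padic_abs p (s m - s n) < 1"
    using assms unfolding padic_Cauchy_def by (metis zero_less_one)
  define B where "B = 1 + (\<Sum>n\<le>N. padic_abs p (s n))"
  have le: "padic_abs p (s n) \<le> (\<Sum>n\<le>N. padic_abs p (s n))" if "n \<le> N" for n
    using that by (intro member_le_sum) auto
  have "padic_abs p (s n) \<le> B" for n
  proof (cases "n \<le> N")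
    case True then show ?thesis using le unfolding B_def by fastforce
  next
    case False
    then show ?thesis using N[of n N] padic_abs_diff_ge[of "s n" "s N"] le[of N]
      unfolding B_def by simp
  qed
  moreover have "B > 0" unfolding B_def by (simp add: add_pos_nonneg sum_nonneg)
  ultimately show thesis using that by blast
qed

lemma padic_Cauchy_mult:
  assumes s: "padic_Cauchy p s" and t: "padic_Cauchy p t"
  shows "padic_Cauchy p (\<lambda>n. s n * t n)"
  unfolding padic_Cauchy_def
proof (intro allI impI)
  fix e :: real assume e: "e > 0"
  obtain B C where B: "B > 0" "\<And>n. padic_abs p (s n) \<le> B"
    and C: "C > 0" "\<And>n. padic_abs p (t n) \<le> C"
    using padic_Cauchy_bounded[OF s] padic_Cauchy_bounded[OF t] by metis
  have "e / C > 0" "e / B > 0" using e B C by auto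
  then obtain M N where M: "\<And>m n. m \<ge> M \<Longrightarrow> n \<ge> M \<Longrightarrow> padic_abs p (s m - s n) < e / C"
    and N: "\<And>m n. m \<ge> N \<Longrightarrow> n \<ge> N \<Longrightarrow> padic_abs p (t m - t n) < e / B"
    using s t unfolding padic_Cauchy_def by metis
  have "padic_abs p (s m * t m - s n * t n) < e" if "m \<ge> max M N" "n \<ge> max M N" for m n
  proof -
    have "padic_abs p (s m - s n) * padic_abs p (t m) \<le> padic_abs p (s m - s n) * C"
      using C by (intro mult_left_mono) auto
    also have "\<dots> < e" using M[of m n] that C by (simp add: field_simps)
    finally have 1: "padic_abs p ((s m - s n) * t m) < e" by simp
    have "padic_abs p (s n) * padic_abs p (t m - t n) \<le> B * padic_abs p (t m - t n)"
      using B by (intro mult_right_mono) auto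
    also have "\<dots> < e" using N[of m n] that B by (simp add: field_simps)
    finally have 2: "padic_abs p (s n * (t m - t n)) < e" by simp
    have "s m * t m - s n * t n = (s m - s n) * t m + s n * (t m - t n)"
      by (simp add: algebra_simps)
    then show ?thesis using 1 2 padic_abs_add_le by (smt (verit) max_def)
  qed
  then show "\<exists>N. \<forall>m\<ge>N. \<forall>n\<ge>N. padic_abs p (s m * t m - s n * t n) < e" by blast
qed

lemma padic_null_iff:
  "padic_null p s \<longleftrightarrow> (\<forall>e>0. \<exists>N. \<forall>n\<ge>N. padic_abs p (s n) < e)"
  by (simp add: padic_null_def LIMSEQ_iff)

lemma padic_null_imp_Cauchy:
  assumes "padic_null p s"
  shows "padic_Cauchy p s"
  unfolding padic_Cauchy_def
proof (intro allI impI)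
  fix e :: real assume "e > 0"
  then obtain N where "\<And>n. n \<ge> N \<Longrightarrow> padic_abs p (s n) < e"
    using assms unfolding padic_null_iff by blast
  then have "padic_abs p (s m - s n) < e" if "m \<ge> N" "n \<ge> N" for m n
    using that padic_abs_add_le[of "s m" "- s n"] padic_abs_minus[of "s n"]
    by (smt (verit) add_uminus_conv_diff)
  then show "\<exists>N. \<forall>m\<ge>N. \<forall>n\<ge>N. padic_abs p (s m - s n) < e" by blast
qed

lemma padic_null_add:
  assumes "padic_null p s" "padic_null p t"
  shows "padic_null p (\<lambda>n. s n + t n)"
proof -
  have "(\<lambda>n. padic_abs p (s n) + padic_abs p (t n)) \<longlonglongrightarrow> 0"
    using tendsto_add[OF assms[unfolded padic_null_def]] by simp
  then show ?thesis unfolding padic_null_def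
    by (rule tendsto_sandwich[OF _ _ tendsto_const, rotated 2])
       (auto intro!: always_eventually simp: padic_abs_add_le_sum)
qed

lemma padic_null_minus: "padic_null p s \<Longrightarrow> padic_null p (\<lambda>n. - s n)"
  by (simp add: padic_null_def)

lemma padic_null_mult:
  assumes s: "padic_null p s" and t: "padic_Cauchy p t"
  shows "padic_null p (\<lambda>n. s n * t n)"
proof -
  obtain B where B: "\<And>n. padic_abs p (t n) \<le> B" using padic_Cauchy_bounded[OF t] by metis
  have "(\<lambda>n. padic_abs p (s n) * B) \<longlonglongrightarrow> 0"
    using tendsto_mult_right[OF s[unfolded padic_null_def], of B] by simp
  then show ?thesis unfolding padic_null_def
    by (rule tendsto_sandwich[OF _ _ tendsto_const, rotated 2])
       (auto intro!: always_eventually simp: B mult_left_mono)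
qed

lemma not_padic_null_one: "\<not> padic_null p (\<lambda>_. 1)"
  by (simp add: padic_null_def LIMSEQ_const_iff)

lemma padic_Cauchy_inverse:
  assumes s: "padic_Cauchy p s" and nn: "\<not> padic_null p s"
  shows "padic_Cauchy p (\<lambda>n. inverse (s n))" "eventually (\<lambda>n. s n \<noteq> 0) sequentially"
proof -
  obtain e where e: "e > 0" and far: "\<And>N. \<exists>n\<ge>N. padic_abs p (s n) \<ge> e"
    using nn unfolding padic_null_iff by (metis not_less)
  obtain K where K: "\<And>m n. m \<ge> K \<Longrightarrow> n \<ge> K \<Longrightarrow> padic_abs p (s m - s n) < e / 2"
    using s e unfolding padic_Cauchy_def by (metis half_gt_zero)
  obtain k where k: "k \<ge> K" "padic_abs p (s k) \<ge> e" using far by blast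
  have low: "padic_abs p (s n) > e / 2" if "n \<ge> K" for n
    using padic_abs_diff_ge[of "s k" "s n"] K[of k n] k that by simp
  have nz: "s n \<noteq> 0" if "n \<ge> K" for n
    using low[OF that] e by auto
  then show "eventually (\<lambda>n. s n \<noteq> 0) sequentially"
    unfolding eventually_sequentially by blast
  show "padic_Cauchy p (\<lambda>n. inverse (s n))"
    unfolding padic_Cauchy_def
  proof (intro allI impI)
    fix d :: real assume d: "d > 0"
    then have "d * (e / 2 * (e / 2)) > 0" using e by simp
    then obtain N where N:
      "\<And>m n. m \<ge> N \<Longrightarrow> n \<ge> N \<Longrightarrow> padic_abs p (s m - s n) < d * (e / 2 * (e / 2))"
      using s unfolding padic_Cauchy_def by metis
    have "padic_abs p (inverse (s m) - inverse (s n)) < d" if "m \<ge> max K N" "n \<ge> max K N" for m n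
    proof -
      have mn: "s m \<noteq> 0" "s n \<noteq> 0" using nz that by auto
      then have *: "inverse (s m) - inverse (s n) = (s n - s m) * inverse (s m * s n)"
        by (simp add: field_simps)
      have "e / 2 * (e / 2) < padic_abs p (s m) * padic_abs p (s n)"
        using low[of m] low[of n] e that by (intro mult_strict_mono) auto
      then have "d * (e / 2 * (e / 2)) < d * (padic_abs p (s m) * padic_abs p (s n))"
        using d by (rule mult_strict_left_mono)
      then have "padic_abs p (s n - s m) < d * (padic_abs p (s m) * padic_abs p (s n))"
        using N[of n m] that by simp
      moreover have "padic_abs p (s m) * padic_abs p (s n) > 0"
        using mn by (metis padic_abs_eq_0_iff padic_abs_nonneg less_eq_real_def mult_pos_pos)
      ultimately show ?thesis unfolding *
        by (simp only: padic_abs_mult padic_abs_inverse)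
           (simp only: pos_divide_less_eq flip: divide_inverse padic_abs_mult)
    qed
    then show "\<exists>N. \<forall>m\<ge>N. \<forall>n\<ge>N. padic_abs p (inverse (s m) - inverse (s n)) < d" by blast
  qed
qed

lemma cring_padic_Cauchy_ring: "cring (padic_Cauchy_ring p)"
proof (rule cringI)
  show "abelian_group (padic_Cauchy_ring p)"
  proof (rule abelian_groupI)
    fix s assume "s \<in> carrier (padic_Cauchy_ring p)"
    then show "\<exists>t\<in>carrier (padic_Cauchy_ring p).
        t \<oplus>\<^bsub>padic_Cauchy_ring p\<^esub> s = \<zero>\<^bsub>padic_Cauchy_ring p\<^esub>"
      by (intro bexI[of _ "\<lambda>n. - s n"])
         (auto simp: padic_Cauchy_ring_def padic_Cauchy_minus)
  qed (auto simp: padic_Cauchy_ring_def padic_Cauchy_add padic_Cauchy_const algebra_simps)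
  show "comm_monoid (padic_Cauchy_ring p)"
    by (rule comm_monoidI)
       (auto simp: padic_Cauchy_ring_def padic_Cauchy_mult padic_Cauchy_const algebra_simps)
qed (auto simp: padic_Cauchy_ring_def algebra_simps)

lemma ideal_padic_null: "ideal {s. padic_null p s} (padic_Cauchy_ring p)"
proof (rule idealI)
  interpret cring "padic_Cauchy_ring p" by (rule cring_padic_Cauchy_ring)
  show "ring (padic_Cauchy_ring p)" by (rule ring_axioms)
  show "subgroup {s. padic_null p s} (add_monoid (padic_Cauchy_ring p))"
  proof (rule add.subgroupI)
    show "{s. padic_null p s} \<subseteq> carrier (padic_Cauchy_ring p)"
      by (auto simp: padic_Cauchy_ring_def padic_null_imp_Cauchy)
    have "(\<lambda>_. 0) \<in> {s. padic_null p s}" by (simp add: padic_null_def)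
    then show "{s. padic_null p s} \<noteq> {}" by blast
    show "\<ominus>\<^bsub>padic_Cauchy_ring p\<^esub> s \<in> {s. padic_null p s}" if "s \<in> {s. padic_null p s}" for s
    proof -
      have "\<ominus>\<^bsub>padic_Cauchy_ring p\<^esub> s = (\<lambda>n. - s n)"
        by (rule minus_equality)
           (use that in \<open>auto simp: padic_Cauchy_ring_def padic_null_imp_Cauchy padic_Cauchy_minus\<close>)
      then show ?thesis using that padic_null_minus by simp
    qed
    show "s \<oplus>\<^bsub>padic_Cauchy_ring p\<^esub> t \<in> {s. padic_null p s}"
      if "s \<in> {s. padic_null p s}" "t \<in> {s. padic_null p s}" for s t
      using that by (simp add: padic_Cauchy_ring_def padic_null_add)
  qed
  show "t \<otimes>\<^bsub>padic_Cauchy_ring p\<^esub> s \<in> {s. padic_null p s}"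
       "s \<otimes>\<^bsub>padic_Cauchy_ring p\<^esub> t \<in> {s. padic_null p s}"
    if "s \<in> {s. padic_null p s}" "t \<in> carrier (padic_Cauchy_ring p)" for s t
    using that padic_null_mult[of s t] by (simp_all add: padic_Cauchy_ring_def mult.commute)
qed

theorem field_Qp: "field (Qp p)"
proof -
  let ?R = "padic_Cauchy_ring p" and ?I = "{s. padic_null p s}"
  interpret I: ideal ?I ?R by (rule ideal_padic_null)
  interpret R: cring ?R by (rule cring_padic_Cauchy_ring)
  interpret Q: cring "Qp p"
    unfolding Qp_def by (rule I.quotient_is_cring) (rule R.is_cring)
  have eqI: "?I +>\<^bsub>?R\<^esub> s = ?I +>\<^bsub>?R\<^esub> t"
    if "padic_null p (\<lambda>n. s n - t n)" "padic_Cauchy p t" for s t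
  proof -
    have "s = (\<lambda>n. s n - t n) \<oplus>\<^bsub>?R\<^esub> t" by (simp add: padic_Cauchy_ring_def)
    then have "s \<in> ?I +>\<^bsub>?R\<^esub> t"
      using that(1) unfolding a_r_coset_def' by blast
    then show ?thesis
      using that(2) I.a_repr_independence'[of s t] by (simp add: padic_Cauchy_ring_def)
  qed
  show ?thesis
  proof (rule Q.cring_fieldI2)
    have "\<one>\<^bsub>?R\<^esub> \<in> ?I +>\<^bsub>?R\<^esub> \<one>\<^bsub>?R\<^esub>" by (rule I.a_rcos_self) simp
    moreover have "\<one>\<^bsub>?R\<^esub> \<notin> ?I" by (simp add: padic_Cauchy_ring_def not_padic_null_one)
    ultimately show "\<zero>\<^bsub>Qp p\<^esub> \<noteq> \<one>\<^bsub>Qp p\<^esub>" by (auto simp: Qp_def FactRing_def)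
  next
    fix a assume a: "a \<in> carrier (Qp p)" "a \<noteq> \<zero>\<^bsub>Qp p\<^esub>"
    then obtain s where s: "padic_Cauchy p s" "a = ?I +>\<^bsub>?R\<^esub> s"
      by (auto simp: Qp_def FactRing_def A_RCOSETS_def' padic_Cauchy_ring_def)
    have nn: "\<not> padic_null p s"
    proof
      assume "padic_null p s"
      then have "a = ?I" using s I.a_rcos_const[of s] by simp
      with a show False by (simp add: Qp_def FactRing_def)
    qed
    define t where "t = (\<lambda>n. inverse (s n))"
    have t: "padic_Cauchy p t" unfolding t_def using padic_Cauchy_inverse(1)[OF s(1) nn] .
    have "eventually (\<lambda>n. padic_abs p (s n * t n - 1) = 0) sequentially"
      using padic_Cauchy_inverse(2)[OF s(1) nn] by eventually_elim (simp add: t_def)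
    then have null: "padic_null p (\<lambda>n. s n * t n - 1)"
      unfolding padic_null_def by (rule tendsto_eventually)
    have "a \<otimes>\<^bsub>Qp p\<^esub> (?I +>\<^bsub>?R\<^esub> t) = ?I +>\<^bsub>?R\<^esub> (s \<otimes>\<^bsub>?R\<^esub> t)"
      using s t I.rcoset_mult_add[of s t]
      by (simp add: Qp_def FactRing_def) (simp add: padic_Cauchy_ring_def)
    also have "\<dots> = \<one>\<^bsub>Qp p\<^esub>"
      using eqI[OF null padic_Cauchy_const] by (simp add: Qp_def FactRing_def padic_Cauchy_ring_def)
    finally have "a \<otimes>\<^bsub>Qp p\<^esub> (?I +>\<^bsub>?R\<^esub> t) = \<one>\<^bsub>Qp p\<^esub>" .
    moreover have "?I +>\<^bsub>?R\<^esub> t \<in> carrier (Qp p)"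
      using t by (auto simp: Qp_def FactRing_def A_RCOSETS_def' padic_Cauchy_ring_def)
    ultimately show "\<exists>b\<in>carrier (Qp p). a \<otimes>\<^bsub>Qp p\<^esub> b = \<one>\<^bsub>Qp p\<^esub>" by blast
  qed
qed

end


section \<open>Places and isotropy\<close>

text \<open>\<open>Fin_place p\<close> is a place only if \<open>p\<close> is prime, whence the set \<open>places\<close>.\<close>

datatype place = Fin_place nat | Inf_place

definition places :: "place set" where
  "places = insert Inf_place (Fin_place ` {p. prime p})"

datatype diag_form = Diag_Form nat nat nat (\<open>\<langle>_, _, _\<rangle>\<close>)

fun eval_form :: "('a, 'b) ring_scheme \<Rightarrow> diag_form \<Rightarrow> 'a \<Rightarrow> 'a \<Rightarrow> 'a \<Rightarrow> 'a" where
  "eval_form R \<langle>a, b, c\<rangle> x y z =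
     [a] \<cdot>\<^bsub>R\<^esub> (x [^]\<^bsub>R\<^esub> (2::nat)) \<oplus>\<^bsub>R\<^esub>
     [b] \<cdot>\<^bsub>R\<^esub> (y [^]\<^bsub>R\<^esub> (2::nat)) \<oplus>\<^bsub>R\<^esub>
     [c] \<cdot>\<^bsub>R\<^esub> (z [^]\<^bsub>R\<^esub> (2::nat))"

definition isotropic_over :: "('a, 'b) ring_scheme \<Rightarrow> diag_form \<Rightarrow> bool" where
  "isotropic_over R Q \<longleftrightarrow>
     (\<exists>x\<in>carrier R. \<exists>y\<in>carrier R. \<exists>z\<in>carrier R.
        \<not> (x = \<zero>\<^bsub>R\<^esub> \<and> y = \<zero>\<^bsub>R\<^esub> \<and> z = \<zero>\<^bsub>R\<^esub>) \<and> eval_form R Q x y z = \<zero>\<^bsub>R\<^esub>)"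

fun isotropic_at :: "place \<Rightarrow> diag_form \<Rightarrow> bool" where
  "isotropic_at (Fin_place p) Q \<longleftrightarrow> isotropic_over (Qp p) Q"
| "isotropic_at Inf_place Q \<longleftrightarrow> isotropic_over (ring_of_type_algebra :: real ring) Q"

abbreviation anisotropic_at :: "place \<Rightarrow> diag_form \<Rightarrow> bool" where
  "anisotropic_at v Q \<equiv> \<not> isotropic_at v Q"

definition anisotropic_precisely_at :: "diag_form \<Rightarrow> place set \<Rightarrow> bool" where
  "anisotropic_precisely_at Q S \<longleftrightarrow> (\<forall>v\<in>places. anisotropic_at v Q \<longleftrightarrow> v \<in> S)"

end

theory Submission
  imports Defs "HOL-Number_Theory.Number_Theory" "HOL-Analysis.Harmonic_Numbers"
begin

text \<open>
  The form \<open>\<langle>1, q, p\<rangle>\<close> is positive definite, hence anisotropic at infinity, and at every odd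
  prime dividing neither \<open>p\<close> nor \<open>q\<close> it has a zero that lifts from the residue field
  (\<open>isotropic_at_odd_good_prime\<close>). So only the primes \<open>p\<close>, \<open>q\<close> and 2 have to be arranged. For odd
  \<open>p\<close> the form is anisotropic at \<open>p\<close> if \<open>- q\<close> is a nonresidue modulo \<open>p\<close>, it is isotropic at an
  odd prime \<open>q \<noteq> p\<close> if \<open>- p\<close> is a residue modulo \<open>q\<close>, and for odd \<open>q\<close> it is isotropic at 2
  as soon as one of \<open>p\<close>, \<open>q\<close> is 3 modulo 4, because then \<open>- (p + q * t ^ 2)\<close> or
  \<open>- (q + p * t ^ 2)\<close> is 1 modulo 8 for a suitable \<open>t\<close>.

  If \<open>p\<close> is 3 modulo 4, then \<open>q = 1\<close> satisfies all of this, since \<open>- 1\<close> is a nonresidue modulo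
  \<open>p\<close>. For \<open>p = 2\<close> the form \<open>\<langle>1, 1, 2\<rangle>\<close> works: it is anisotropic at 2 by a computation modulo 8.
  If \<open>p\<close> is 1 modulo 4, a prime \<open>q\<close> that is 3 modulo 4 and a nonresidue modulo \<open>p\<close> is needed;
  quadratic reciprocity then makes \<open>- p\<close> a residue modulo \<open>q\<close>.

  Such a prime exists by an averaging argument (\<open>exists_prime_3_mod_4_nonresidue\<close>). Let \<open>g\<close> be the
  nonprincipal character modulo 4 and \<open>h\<close> the quadratic character modulo \<open>p\<close>, set to 0 at even
  numbers, and let \<open>f\<close> be their Dirichlet convolution. If no prime had \<open>g q = h q = - 1\<close>, then \<open>f\<close>
  would be nonnegative and at least 1 at every odd square (\<open>convolution_sign\<close>), so that the sum of
  \<open>f n / sqrt n\<close> over \<open>n \<le> A ^ 2\<close> would be at least the sum of \<open>1 / m\<close> over odd \<open>m \<le> A\<close> and tend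
  to infinity. But both \<open>g\<close> and \<open>h\<close> have bounded partial sums, and the hyperbola method shows that
  the same sum is bounded (\<open>bounded_hyperbola_sum\<close>).
\<close>

section \<open>A bounded sum of a Dirichlet convolution\<close>

text \<open>
  Summation by parts: bounded partial sums stay under control after weighting by a
  decreasing sequence, and the tail is as small as its first weight.
\<close>
lemma abs_weighted_sum_le:
  fixes c w :: "nat \<Rightarrow> real"
  assumes partial: "\<And>k. \<bar>\<Sum>n=1..k. c n\<bar> \<le> B"
    and dec: "\<And>n. n \<ge> 1 \<Longrightarrow> w (Suc n) \<le> w n" and nonneg: "\<And>n. w n \<ge> 0" and "M \<le> N"
  shows "\<bar>\<Sum>n\<in>{M<..N}. c n * w n\<bar> \<le> 2 * B * w (Suc M)"
proof -
  define C where "C k = (\<Sum>n=1..k. c n)" for k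
  have C: "\<bar>C k\<bar> \<le> B" for k
    using partial by (simp add: C_def)
  have B: "B \<ge> 0" using C[of 0] by linarith
  have step: "{M<..Suc n} = insert (Suc n) {M<..n}" if "M \<le> n" for n
    using that by auto
  have *: "(\<Sum>n\<in>{M<..N}. c n * w n) =
      C N * w (Suc N) - C M * w (Suc M) + (\<Sum>n\<in>{M<..N}. C n * (w n - w (Suc n)))"
    using \<open>M \<le> N\<close>
    by (induction N rule: dec_induct) (auto simp: step C_def algebra_simps)
  have tele: "(\<Sum>n\<in>{M<..N}. w n - w (Suc n)) = w (Suc M) - w (Suc N)"
    using \<open>M \<le> N\<close> by (induction N rule: dec_induct) (auto simp: step)
  have "\<bar>\<Sum>n\<in>{M<..N}. C n * (w n - w (Suc n))\<bar> \<le> (\<Sum>n\<in>{M<..N}. B * (w n - w (Suc n)))"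
    using B C dec by (intro order.trans[OF sum_abs] sum_mono) (auto simp: abs_mult intro!: mult_mono)
  also have "\<dots> = B * (w (Suc M) - w (Suc N))"
    by (simp only: tele flip: sum_distrib_left)
  finally have 1: "\<bar>\<Sum>n\<in>{M<..N}. C n * (w n - w (Suc n))\<bar> \<le> B * (w (Suc M) - w (Suc N))" .
  have 2: "\<bar>C N * w (Suc N)\<bar> \<le> B * w (Suc N)" "\<bar>C M * w (Suc M)\<bar> \<le> B * w (Suc M)"
    using C nonneg by (auto simp: abs_mult intro!: mult_right_mono)
  show ?thesis
    unfolding * using 1 2 by (simp add: algebra_simps)
qed

lemma sum_inverse_sqrt_le: "(\<Sum>n=1..A. 1 / sqrt (real n)) \<le> 2 * sqrt (real A)"
proof (induction A)
  case (Suc A)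
  define s t where "s = sqrt (real A)" and "t = sqrt (real (Suc A))"
  have "t > 0" "t\<^sup>2 = s\<^sup>2 + 1"
    by (simp_all add: s_def t_def)
  moreover have "0 \<le> (t - s)\<^sup>2" by simp
  ultimately have "2 * s + 1 / t \<le> 2 * t"
    by (simp add: field_simps power2_eq_square)
  then show ?case using Suc by (simp add: s_def t_def)
qed simp

definition dirichlet_conv :: "(nat \<Rightarrow> real) \<Rightarrow> (nat \<Rightarrow> real) \<Rightarrow> nat \<Rightarrow> real" where
  "dirichlet_conv g h n = (\<Sum>d | d dvd n. g d * h (n div d))"

text \<open>
  Summing over the divisors of every \<open>n \<le> N\<close> is summing over the lattice points under
  the hyperbola \<open>a * b = N\<close>.
\<close>
lemma sum_divisors_eq_sum_pairs:
  fixes F :: "nat \<Rightarrow> nat \<Rightarrow> 'a::comm_monoid_add"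
  shows "(\<Sum>n=1..N. \<Sum>d | d dvd n. F d (n div d)) = (\<Sum>(a, b)\<in>{(a, b). 1 \<le> a \<and> 1 \<le> b \<and> a * b \<le> N}. F a b)"
proof -
  have "(\<Sum>n=1..N. \<Sum>d | d dvd n. F d (n div d)) =
      (\<Sum>(n, d)\<in>(SIGMA n:{1..N}. {d. d dvd n}). F d (n div d))"
    by (rule sum.Sigma) auto
  also have "\<dots> = (\<Sum>(a, b)\<in>{(a, b). 1 \<le> a \<and> 1 \<le> b \<and> a * b \<le> N}. F a b)"
    by (rule sum.reindex_bij_witness[of _ "\<lambda>(a, b). (a * b, a)" "\<lambda>(n, d). (d, n div d)"])
       (auto simp: Suc_le_eq dvd_div_eq_0_iff intro: Nat.gr0I)
  finally show ?thesis .
qed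

text \<open>
  Dirichlet's hyperbola method: a point under \<open>a * b = A * A\<close> has \<open>a \<le> A\<close>, or else
  \<open>a > A\<close> and then necessarily \<open>b \<le> A\<close>.
\<close>
lemma hyperbola_split:
  fixes G H :: "nat \<Rightarrow> real"
  shows "(\<Sum>n=1..A * A. dirichlet_conv G H n) =
    (\<Sum>a=1..A. G a * (\<Sum>b=1..A * A div a. H b)) +
    (\<Sum>b=1..A. H b * (\<Sum>a\<in>{A<..A * A div b}. G a))"
proof -
  define N where "N = A * A"
  let ?S = "SIGMA a:{1..A}. {1..N div a}" and ?T = "SIGMA b:{1..A}. {A<..N div b}"
  have le: "b \<le> A" if "a * b \<le> N" "A < a" for a b
  proof (rule ccontr)
    assume "\<not> b \<le> A"
    then have "Suc A * Suc A \<le> a * b" using that by (intro mult_mono) auto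
    with that show False by (simp add: N_def)
  qed
  have P: "{(a, b). 1 \<le> a \<and> 1 \<le> b \<and> a * b \<le> N} = ?S \<union> prod.swap ` ?T" (is "?P = _")
  proof (intro equalityI subsetI)
    fix x assume "x \<in> ?P"
    then obtain a b where x: "x = (a, b)" "1 \<le> a" "1 \<le> b" "a * b \<le> N" by auto
    have "b \<le> N div a" "a \<le> N div b"
      using x by (simp_all add: less_eq_div_iff_mult_less_eq mult.commute)
    then show "x \<in> ?S \<union> prod.swap ` ?T"
      using x le by (cases "a \<le> A") (force simp: image_iff)+
  next
    fix x assume "x \<in> ?S \<union> prod.swap ` ?T"
    then show "x \<in> ?P"
      by (auto simp: less_eq_div_iff_mult_less_eq mult.commute)
  qed
  have "(\<Sum>n=1..N. \<Sum>d | d dvd n. G d * H (n div d)) = (\<Sum>(a, b)\<in>?S \<union> prod.swap ` ?T. G a * H b)"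
    using sum_divisors_eq_sum_pairs[of "\<lambda>a b. G a * H b" N] unfolding P .
  also have "\<dots> = (\<Sum>(a, b)\<in>?S. G a * H b) + (\<Sum>(a, b)\<in>prod.swap ` ?T. G a * H b)"
    by (rule sum.union_disjoint) auto
  also have "(\<Sum>(a, b)\<in>prod.swap ` ?T. G a * H b) = (\<Sum>(b, a)\<in>?T. H b * G a)"
    by (subst sum.reindex) (auto simp: case_prod_beta mult.commute)
  finally show ?thesis
    by (simp add: N_def sum.Sigma[symmetric] sum_distrib_left dirichlet_conv_def)
qed

text \<open>
  With weights \<open>1 / sqrt n\<close> the two error terms of the hyperbola method are each a sum of
  \<open>A\<close> terms \<open>1 / sqrt a\<close>, of order \<open>sqrt A\<close>, times a tail of order \<open>1 / sqrt A\<close>. They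
  balance, and the main term is a product of two bounded sums.
\<close>
lemma bounded_hyperbola_sum:
  fixes g h :: "nat \<Rightarrow> real"
  assumes g: "\<And>k. \<bar>\<Sum>n=1..k. g n\<bar> \<le> B" and h: "\<And>k. \<bar>\<Sum>n=1..k. h n\<bar> \<le> B"
    and g1: "\<And>n. \<bar>g n\<bar> \<le> 1" and h1: "\<And>n. \<bar>h n\<bar> \<le> 1"
  shows "(\<Sum>n=1..A * A. dirichlet_conv g h n / sqrt (real n)) \<le> 4 * B * B + 8 * B"
proof -
  define G H where "G n = g n / sqrt (real n)" and "H n = h n / sqrt (real n)" for n
  have B: "B \<ge> 0" using g[of 0] by linarith
  have tail: "\<bar>\<Sum>n\<in>{M<..N}. c n / sqrt (real n)\<bar> \<le> 2 * B / sqrt (real (Suc M))"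
    if "\<And>k. \<bar>\<Sum>n=1..k. c n\<bar> \<le> B" "M \<le> N" for c M N
    using abs_weighted_sum_le[OF that(1), of "\<lambda>n. 1 / sqrt (real n)" M N] that(2)
    by (simp add: frac_le)
  have I: "{0<..k} = {1..k}" for k :: nat by auto
  have SG: "\<bar>\<Sum>n=1..A. G n\<bar> \<le> 2 * B" and SH: "\<bar>\<Sum>n=1..A. H n\<bar> \<le> 2 * B"
    using tail[OF g, of 0 A] tail[OF h, of 0 A] by (simp_all add: G_def H_def I)
  have le: "A \<le> A * A div a" if "a \<in> {1..A}" for a
    using that by (auto simp: less_eq_div_iff_mult_less_eq)
  have err: "\<bar>\<Sum>a=1..A. u a / sqrt (real a) * (\<Sum>b\<in>{A<..A * A div a}. v b / sqrt (real b))\<bar> \<le> 4 * B"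
    if v: "\<And>k. \<bar>\<Sum>n=1..k. v n\<bar> \<le> B" and u1: "\<And>n. \<bar>u n\<bar> \<le> 1" for u v
  proof -
    have "\<bar>\<Sum>a=1..A. u a / sqrt (real a) * (\<Sum>b\<in>{A<..A * A div a}. v b / sqrt (real b))\<bar>
        \<le> (\<Sum>a=1..A. 1 / sqrt (real a) * (2 * B / sqrt (real (Suc A))))"
      using u1 B le
      by (intro order.trans[OF sum_abs] sum_mono)
         (auto simp only: abs_mult intro!: mult_mono tail[OF v] abs_ge_zero,
          auto simp: divide_right_mono)
    also have "\<dots> = (\<Sum>a=1..A. 1 / sqrt (real a)) * (2 * B / sqrt (real (Suc A)))"
      by (rule sum_distrib_right[symmetric])
    also have "\<dots> \<le> 2 * sqrt (real A) * (2 * B / sqrt (real (Suc A)))"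
      using B by (intro mult_right_mono sum_inverse_sqrt_le) auto
    also have "\<dots> = 4 * B * (sqrt (real A) / sqrt (real (Suc A)))" by simp
    also have "\<dots> \<le> 4 * B * 1"
      using B by (intro mult_left_mono) auto
    finally show ?thesis by simp
  qed
  have "(\<Sum>n=1..A * A. dirichlet_conv g h n / sqrt (real n)) =
      (\<Sum>n=1..A * A. dirichlet_conv G H n)"
    unfolding dirichlet_conv_def sum_divide_distrib
    by (intro sum.cong refl) (auto simp: G_def H_def simp flip: real_sqrt_mult of_nat_mult)
  also have "\<dots> = (\<Sum>a=1..A. G a * (\<Sum>b=1..A * A div a. H b)) +
      (\<Sum>b=1..A. H b * (\<Sum>a\<in>{A<..A * A div b}. G a))"
    by (rule hyperbola_split)
  also have "(\<Sum>a=1..A. G a * (\<Sum>b=1..A * A div a. H b)) =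
      (\<Sum>a=1..A. G a * (\<Sum>b=1..A. H b) + G a * (\<Sum>b\<in>{A<..A * A div a}. H b))"
  proof (intro sum.cong refl)
    fix a assume "a \<in> {1..A}"
    then have "{1..A * A div a} = {1..A} \<union> {A<..A * A div a}"
      using le[of a] by auto
    then have "(\<Sum>b=1..A * A div a. H b) = (\<Sum>b=1..A. H b) + (\<Sum>b\<in>{A<..A * A div a}. H b)"
      by (simp only:) (rule sum.union_disjoint, auto)
    then show "G a * (\<Sum>b=1..A * A div a. H b) = G a * (\<Sum>b=1..A. H b) + G a * (\<Sum>b\<in>{A<..A * A div a}. H b)"
      by (simp only: distrib_left)
  qed
  also have "\<dots> = (\<Sum>a=1..A. G a) * (\<Sum>b=1..A. H b) + (\<Sum>a=1..A. G a * (\<Sum>b\<in>{A<..A * A div a}. H b))"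
    by (simp only: sum.distrib sum_distrib_right)
  finally have eq: "(\<Sum>n=1..A * A. dirichlet_conv g h n / sqrt (real n)) =
      (\<Sum>a=1..A. G a) * (\<Sum>b=1..A. H b) + (\<Sum>a=1..A. G a * (\<Sum>b\<in>{A<..A * A div a}. H b)) +
      (\<Sum>b=1..A. H b * (\<Sum>a\<in>{A<..A * A div b}. G a))" .
  have "\<bar>(\<Sum>a=1..A. G a) * (\<Sum>b=1..A. H b)\<bar> \<le> 2 * B * (2 * B)"
    unfolding abs_mult using SG SH B by (intro mult_mono) auto
  then show ?thesis
    using err[where u = g and v = h, OF h g1] err[where u = h and v = g, OF g h1] unfolding eq G_def H_def by linarith
qed

section \<open>Partial sums of periodic multiplicative functions\<close>

text \<open>
  Multiplication by the unit \<open>u\<close> permutes the residues modulo \<open>m\<close>, so the sum over a period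
  equals \<open>c u\<close> times itself.
\<close>
lemma periodic_sum_zero:
  fixes c :: "nat \<Rightarrow> real"
  assumes per: "\<And>n. c (n mod m) = c n" and mult: "\<And>a b. c (a * b) = c a * c b"
    and u: "coprime u m" "c u \<noteq> 1" and m: "m > 0"
  shows "(\<Sum>n<m. c n) = 0"
proof -
  have "bij_betw (\<lambda>n. u * n mod m) {..<m} {..<m}"
  proof -
    have inj: "inj_on (\<lambda>n. u * n mod m) {..<m}"
    proof (rule inj_onI)
      fix x y assume xy: "x \<in> {..<m}" "y \<in> {..<m}" "u * x mod m = u * y mod m"
      then have "[x = y] (mod m)"
        using u by (simp add: cong_mult_lcancel_nat flip: cong_def)
      with xy show "x = y" by (simp add: cong_def)
    qed
    then show ?thesis
      using m by (simp add: bij_betw_def endo_inj_surj image_subset_iff)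
  qed
  then have "(\<Sum>n<m. c n) = (\<Sum>n<m. c (u * n mod m))"
    by (rule sum.reindex_bij_betw[symmetric])
  also have "\<dots> = c u * (\<Sum>n<m. c n)"
    by (simp only: per mult sum_distrib_left)
  finally show ?thesis using u by simp
qed

text \<open>
  Complete periods cancel, and what remains has fewer than \<open>m\<close> terms of size at most 1.
\<close>
lemma periodic_partial_sum_bound:
  fixes c :: "nat \<Rightarrow> real"
  assumes per: "\<And>n. c (n mod m) = c n" and zero: "(\<Sum>n<m. c n) = 0"
    and le1: "\<And>n. \<bar>c n\<bar> \<le> 1" and "c 0 = 0" and m: "m > 0"
  shows "\<bar>\<Sum>n=1..k. c n\<bar> \<le> real m"
proof -
  have per': "c (n + m * j) = c n" for n j
    by (metis per mod_mult_self2)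
  have full: "(\<Sum>n<m * j. c n) = 0" for j
  proof (induction j)
    case (Suc j)
    have "(\<Sum>n<m * Suc j. c n) = (\<Sum>n<m * j. c n) + (\<Sum>n=m * j..<m * j + m. c n)"
      by (simp add: lessThan_atLeast0 sum.atLeastLessThan_concat add.commute)
    also have "(\<Sum>n=m * j..<m * j + m. c n) = (\<Sum>n<m. c (n + m * j))"
      using sum.shift_bounds_nat_ivl[of c 0 "m * j" m] by (simp add: lessThan_atLeast0 add.commute)
    finally show ?case using Suc zero by (simp add: per')
  qed simp
  define j where "j = Suc k div m"
  have k: "Suc k = m * j + Suc k mod m" by (simp add: j_def)
  have "(\<Sum>n=1..k. c n) = (\<Sum>n<Suc k. c n)"
    using \<open>c 0 = 0\<close> by (simp add: lessThan_Suc_atMost atMost_atLeast0 sum.atLeast_Suc_atMost)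
  also have "\<dots> = (\<Sum>n<m * j. c n) + (\<Sum>n=m * j..<m * j + Suc k mod m. c n)"
    by (subst k) (simp add: lessThan_atLeast0 sum.atLeastLessThan_concat)
  finally have "(\<Sum>n=1..k. c n) = (\<Sum>n=m * j..<m * j + Suc k mod m. c n)"
    by (simp add: full)
  also have "\<bar>\<dots>\<bar> \<le> (\<Sum>n=m * j..<m * j + Suc k mod m. 1)"
    by (intro order.trans[OF sum_abs] sum_mono le1)
  also have "\<dots> \<le> real m" using m by (simp add: less_imp_le)
  finally show ?thesis .
qed




section \<open>Signs of convolutions of multiplicative functions\<close>

text \<open>
  A divisor of \<open>a * b\<close> with \<open>a\<close>, \<open>b\<close> coprime is uniquely a divisor of \<open>a\<close> times a divisor of
  \<open>b\<close>; its two factors are its greatest common divisors with \<open>a\<close> and \<open>b\<close>.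
\<close>
lemma dirichlet_conv_coprime_mult:
  fixes g h :: "nat \<Rightarrow> real"
  assumes g: "\<And>a b. g (a * b) = g a * g b" and h: "\<And>a b. h (a * b) = h a * h b"
    and ab: "coprime a b" "a > 0" "b > 0"
  shows "dirichlet_conv g h (a * b) = dirichlet_conv g h a * dirichlet_conv g h b"
proof -
  have gcd_eq: "gcd (d * e) a = d" "gcd (d * e) b = e" if "d dvd a" "e dvd b" for d e
  proof -
    have "coprime a e" "coprime b d"
      using that ab(1) by (metis coprime_commute coprime_divisors dvd_refl)+
    then show "gcd (d * e) a = d" "gcd (d * e) b = e"
      using that by (auto simp: gcd_mult_left_right_cancel gcd_mult_left_left_cancel gcd_nat.absorb1)
  qed
  have "(\<Sum>d | d dvd a. g d * h (a div d)) * (\<Sum>e | e dvd b. g e * h (b div e)) =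
      (\<Sum>(d, e)\<in>{d. d dvd a} \<times> {e. e dvd b}. g d * h (a div d) * (g e * h (b div e)))"
    by (simp add: sum_product sum.cartesian_product)
  also have "\<dots> = (\<Sum>d | d dvd a * b. g d * h (a * b div d))"
  proof (rule sum.reindex_bij_witness[of _ "\<lambda>t. (gcd t a, gcd t b)" "\<lambda>(d, e). d * e"])
    fix t assume t: "t \<in> {d. d dvd a * b}"
    obtain d e where "t = d * e" "d dvd a" "e dvd b"
      using division_decomp[of t a b] t by auto
    then show "(case (gcd t a, gcd t b) of (d, e) \<Rightarrow> d * e) = t"
      by (simp add: gcd_eq)
    show "(gcd t a, gcd t b) \<in> {d. d dvd a} \<times> {e. e dvd b}" by simp
  next
    fix x assume "x \<in> {d. d dvd a} \<times> {e. e dvd b}"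
    then obtain d e where x: "x = (d, e)" "d dvd a" "e dvd b" by auto
    then show "(gcd (case x of (d, e) \<Rightarrow> d * e) a, gcd (case x of (d, e) \<Rightarrow> d * e) b) = x"
      by (simp add: gcd_eq)
    show "(case x of (d, e) \<Rightarrow> d * e) \<in> {d. d dvd a * b}"
      using x by (simp add: mult_dvd_mono)
    show "g (case x of (d, e) \<Rightarrow> d * e) * h (a * b div (case x of (d, e) \<Rightarrow> d * e)) =
        (case x of (d, e) \<Rightarrow> g d * h (a div d) * (g e * h (b div e)))"
      using x by (simp add: div_mult_div_if_dvd[symmetric] g h)
  qed
  finally show ?thesis by (simp add: dirichlet_conv_def)
qed

lemma dirichlet_conv_prime_power:
  fixes g h :: "nat \<Rightarrow> real"
  assumes g: "\<And>a b. g (a * b) = g a * g b" "g 1 = 1" and h: "\<And>a b. h (a * b) = h a * h b" "h 1 = 1"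
    and q: "prime q"
  shows "dirichlet_conv g h (q ^ k) = (\<Sum>i\<le>k. g q ^ i * h q ^ (k - i))"
proof -
  have pow: "g (q ^ i) = g q ^ i" "h (q ^ i) = h q ^ i" for i
    using g h by (induction i) auto
  have "{d. d dvd q ^ k} = (\<lambda>i. q ^ i) ` {..k}"
    using q by (auto simp: divides_primepow_nat)
  moreover have "inj_on (\<lambda>i. q ^ i) {..k}"
    using prime_gt_1_nat[OF q] by (auto intro!: inj_onI)
  ultimately show ?thesis
    using prime_gt_0_nat[OF q]
    by (simp add: dirichlet_conv_def sum.reindex pow flip: power_diff)
qed

lemma sum_powers_sign:
  fixes t :: real
  assumes "t \<in> {-1, 0, 1}"
  shows "(\<Sum>i\<le>k. t ^ i) \<ge> 0" "even k \<Longrightarrow> (\<Sum>i\<le>k. t ^ i) \<ge> 1"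
proof -
  have "(\<Sum>i\<le>k. t ^ i) \<ge> 0 \<and> (\<Sum>i\<le>k. t ^ i) \<le> real (Suc k) \<and>
      (t = -1 \<longrightarrow> (\<Sum>i\<le>k. t ^ i) = (if even k then 1 else 0)) \<and> (t \<noteq> -1 \<longrightarrow> (\<Sum>i\<le>k. t ^ i) \<ge> 1)"
    using assms by (induction k) auto
  then show "(\<Sum>i\<le>k. t ^ i) \<ge> 0" "even k \<Longrightarrow> (\<Sum>i\<le>k. t ^ i) \<ge> 1"
    by (auto split: if_splits)
qed

text \<open>
  These sums are the values of the convolution at prime powers. The condition
  \<open>u + v \<ge> 0\<close> leaves only the cases \<open>u = 1\<close>, \<open>v = 1\<close> and \<open>u = v = 0\<close>, so the sum is a
  geometric one with ratio in \<open>{-1, 0, 1}\<close>, or vanishes for \<open>k > 0\<close>.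
\<close>
lemma sum_mixed_powers_sign:
  fixes u v :: real
  assumes "u \<in> {-1, 0, 1}" "v \<in> {-1, 0, 1}" "u + v \<ge> 0"
  shows "(\<Sum>i\<le>k. u ^ i * v ^ (k - i)) \<ge> 0"
    and "even k \<Longrightarrow> u \<noteq> 0 \<or> v \<noteq> 0 \<Longrightarrow> (\<Sum>i\<le>k. u ^ i * v ^ (k - i)) \<ge> 1"
proof -
  have rev: "(\<Sum>i\<le>k. v ^ (k - i)) = (\<Sum>i\<le>k. v ^ i)"
    by (rule sum.reindex_bij_witness[of _ "\<lambda>i. k - i" "\<lambda>i. k - i"]) auto
  consider "u = 1" | "v = 1" | "u = 0" "v = 0"
    using assms by auto
  note c = this
  show "(\<Sum>i\<le>k. u ^ i * v ^ (k - i)) \<ge> 0"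
    using c
  proof cases
    case 1 then show ?thesis using sum_powers_sign(1)[OF assms(2)] by (simp add: rev)
  next
    case 2 then show ?thesis using sum_powers_sign(1)[OF assms(1)] by simp
  qed (simp add: sum_nonneg)
  show "(\<Sum>i\<le>k. u ^ i * v ^ (k - i)) \<ge> 1" if "even k" "u \<noteq> 0 \<or> v \<noteq> 0"
    using c
  proof cases
    case 1 then show ?thesis using sum_powers_sign(2)[OF assms(2) that(1)] by (simp add: rev)
  next
    case 2 then show ?thesis using sum_powers_sign(2)[OF assms(1) that(1)] by simp
  qed (use that in simp)
qed

text \<open>
  By multiplicativity everything reduces to prime powers; squares only involve even
  exponents, where the prime-power values are at least 1 instead of merely nonnegative.
\<close>
lemma convolution_sign:
  fixes g h :: "nat \<Rightarrow> real"
  assumes g: "\<And>a b. g (a * b) = g a * g b" "g 1 = 1" "\<And>n. g n \<in> {-1, 0, 1}"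
    and h: "\<And>a b. h (a * b) = h a * h b" "h 1 = 1" "\<And>n. h n \<in> {-1, 0, 1}"
    and compat: "\<And>q. prime q \<Longrightarrow> g q + h q \<ge> 0" and "n > 0"
  shows "dirichlet_conv g h n \<ge> 0"
    and "(\<And>q. prime q \<Longrightarrow> q dvd n \<Longrightarrow> g q \<noteq> 0 \<or> h q \<noteq> 0) \<Longrightarrow> dirichlet_conv g h (n ^ 2) \<ge> 1"
proof -
  let ?f = "dirichlet_conv g h"
  let ?supp = "\<lambda>n. \<forall>q. prime q \<longrightarrow> q dvd n \<longrightarrow> g q \<noteq> 0 \<or> h q \<noteq> 0"
  have "?f n \<ge> 0 \<and> (?supp n \<longrightarrow> ?f (n ^ 2) \<ge> 1)"
    using \<open>n > 0\<close>
  proof (induction n rule: less_induct)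
    case (less n)
    show ?case
    proof (cases "n = 1")
      case True
      then show ?thesis using g h by (simp add: dirichlet_conv_def)
    next
      case False
      then obtain q where q: "prime q" "q dvd n" using prime_factor_nat by blast
      obtain m where m: "n = q ^ multiplicity q n * m" "\<not> q dvd m"
        using multiplicity_decompose'[of n q] less.prems q by (metis neq0_conv not_prime_unit)
      define k where "k = multiplicity q n"
      have k: "n = q ^ k * m" using m by (simp add: k_def)
      have "k > 0" using q less.prems by (simp add: k_def prime_multiplicity_gt_zero_iff)
      have "m > 0" using less.prems k by (auto intro: Nat.gr0I)
      have "m < n" using k \<open>k > 0\<close> \<open>m > 0\<close> one_less_power[OF prime_gt_1_nat[OF q(1)], of k] by simp
      then have IH: "?f m \<ge> 0" "?supp m \<Longrightarrow> ?f (m ^ 2) \<ge> 1"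
        using less.IH \<open>m > 0\<close> by auto
      have cop: "coprime (q ^ i) (m ^ j)" for i j
        using m(2) q(1) by (simp add: prime_imp_coprime)
      have split: "?f (q ^ i * m ^ j) = (\<Sum>l\<le>i. g q ^ l * h q ^ (i - l)) * ?f (m ^ j)" for i j
        using dirichlet_conv_coprime_mult[OF g(1) h(1) cop, of i j] \<open>m > 0\<close> prime_gt_0_nat[OF q(1)]
        by (simp add: dirichlet_conv_prime_power[OF g(1,2) h(1,2) q(1)])
      note sign = sum_mixed_powers_sign[OF g(3) h(3) compat[OF q(1)]]
      have "?f n \<ge> 0"
        using split[of k 1] IH(1) sign(1)[of k] by (simp flip: k)
      moreover have "?f (n ^ 2) \<ge> 1" if "?supp n"
      proof -
        have "?supp m" using that k by (metis dvd_mult)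
        then have "?f (m ^ 2) \<ge> 1" by (rule IH)
        moreover have "(\<Sum>l\<le>k * 2. g q ^ l * h q ^ (k * 2 - l)) \<ge> 1"
          using that q by (intro sign(2)) auto
        ultimately show ?thesis
          using split[of "k * 2" 2] mult_mono[of 1 "\<Sum>l\<le>k * 2. g q ^ l * h q ^ (k * 2 - l)" 1 "?f (m ^ 2)"]
          by (simp add: k power_mult_distrib power_mult)
      qed
      ultimately show ?thesis by blast
    qed
  qed
  then show "?f n \<ge> 0"
    and "(\<And>q. prime q \<Longrightarrow> q dvd n \<Longrightarrow> g q \<noteq> 0 \<or> h q \<noteq> 0) \<Longrightarrow> ?f (n ^ 2) \<ge> 1"
    by auto
qed

text \<open>
  If no such prime existed, the convolution would be nonnegative everywhere and at least 1
  at odd squares. Its sum with weights \<open>1 / sqrt n\<close> would then dominate the harmonic series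
  over the odd numbers, contradicting the bound from the hyperbola method.
\<close>
lemma exists_prime_negative_for_both:
  fixes g h :: "nat \<Rightarrow> real"
  assumes g: "\<And>a b. g (a * b) = g a * g b" "g 1 = 1" "\<And>n. g n \<in> {-1, 0, 1}"
    and h: "\<And>a b. h (a * b) = h a * h b" "h 1 = 1" "\<And>n. h n \<in> {-1, 0, 1}"
    and bound: "\<And>k. \<bar>\<Sum>n=1..k. g n\<bar> \<le> B" "\<And>k. \<bar>\<Sum>n=1..k. h n\<bar> \<le> B"
    and supp: "\<And>q. prime q \<Longrightarrow> q \<noteq> 2 \<Longrightarrow> g q \<noteq> 0 \<or> h q \<noteq> 0"
  shows "\<exists>q. prime q \<and> g q + h q < 0"
proof (rule ccontr)
  assume "\<not> ?thesis"
  then have compat: "g q + h q \<ge> 0" if "prime q" for q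
    using that by (meson not_less)
  define f where "f = dirichlet_conv g h"
  have f0: "f n \<ge> 0" if "n > 0" for n
    unfolding f_def using convolution_sign(1)[OF g h compat that] by simp
  have f1: "f (m ^ 2) \<ge> 1" if "odd m" for m
  proof -
    have "g q \<noteq> 0 \<or> h q \<noteq> 0" if "prime q" "q dvd m" for q
      using supp[of q] that \<open>odd m\<close> by auto
    then show ?thesis
      unfolding f_def using odd_pos[OF that] by (intro convolution_sign(2)[OF g h compat])
  qed
  have le1: "\<bar>g n\<bar> \<le> 1" "\<bar>h n\<bar> \<le> 1" for n
    using g(3)[of n] h(3)[of n] by auto
  have harm: "harm K / 2 \<le> 4 * B * B + 8 * B" for K
  proof -
    \<comment> \<open>Compare \<open>1 / (2 * k + 2)\<close> with the weight \<open>1 / (2 * k + 1)\<close> of the odd square \<open>(2 * k + 1) ^ 2\<close>.\<close>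
    have "harm K / 2 = (\<Sum>k<K. 1 / (2 * real (Suc k)))"
      unfolding harm_altdef sum_divide_distrib by (intro sum.cong refl) (simp add: divide_simps)
    also have "\<dots> \<le> (\<Sum>k<K. f ((2 * k + 1) ^ 2) / sqrt (real ((2 * k + 1) ^ 2)))"
      by (intro sum_mono frac_le f1) (auto simp: real_sqrt_power intro!: f0)
    also have "\<dots> = (\<Sum>n\<in>(\<lambda>k. (2 * k + 1) ^ 2) ` {..<K}. f n / sqrt (real n))"
      by (subst sum.reindex) (auto intro!: inj_onI)
    also have "\<dots> \<le> (\<Sum>n=1..(2 * K) * (2 * K). f n / sqrt (real n))"
    proof (intro sum_mono2)
      have "(2 * k + 1) ^ 2 \<le> (2 * K) * (2 * K)" if "k < K" for k
        using that unfolding power2_eq_square by (intro mult_mono) auto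
      then show "(\<lambda>k. (2 * k + 1) ^ 2) ` {..<K} \<subseteq> {1..(2 * K) * (2 * K)}"
        by (auto simp del: power2_sum)
    qed (auto intro!: divide_nonneg_nonneg f0)
    also have "\<dots> \<le> 4 * B * B + 8 * B"
      unfolding f_def by (rule bounded_hyperbola_sum[OF bound le1])
    finally show ?thesis .
  qed
  obtain K where "harm K > 8 * B * B + 16 * B"
  proof -
    have "\<forall>\<^sub>F K in sequentially. 8 * B * B + 16 * B < harm K"
      using harm_at_top unfolding filterlim_at_top_dense by (rule spec)
    then show ?thesis
      using that unfolding eventually_sequentially by fast
  qed
  then show False using harm[of K] by simp
qed



section \<open>Primes that are 3 modulo 4 and nonresidues modulo a given prime\<close>

lemma Legendre_cases: "Legendre a p \<in> {-1, 0, 1}"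
  by (auto simp: Legendre_def)

lemma Legendre_cong: "[a = b] (mod p) \<Longrightarrow> Legendre a p = Legendre b p"
  by (simp add: Legendre_def QuadRes_def cong_def)

text \<open>
  Congruent values in \<open>{-1, 0, 1}\<close> agree because they differ by at most 2.
\<close>
lemma Legendre_eqI:
  assumes "[x = y] (mod p)" "x \<in> {-1, 0, 1}" "y \<in> {-1, 0, 1}" "(p::int) > 2"
  shows "x = y"
proof -
  have "p dvd x - y" using assms(1) by (simp add: cong_iff_dvd_diff)
  moreover have "\<bar>x - y\<bar> < p" using assms by auto
  ultimately show ?thesis using zdvd_imp_le[of p "\<bar>x - y\<bar>"] by (cases "x = y") auto
qed

lemma Legendre_mult:
  fixes p :: nat
  assumes p: "prime p" "p > 2"
  shows "Legendre (a * b) (int p) = Legendre a (int p) * Legendre b (int p)"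
proof (rule Legendre_eqI)
  note E = euler_criterion[OF p]
  have "[Legendre (a * b) (int p) = a ^ ((p - 1) div 2) * b ^ ((p - 1) div 2)] (mod int p)"
    using E[of "a * b"] by (simp add: power_mult_distrib)
  also have "[a ^ ((p - 1) div 2) * b ^ ((p - 1) div 2) = Legendre a (int p) * Legendre b (int p)] (mod int p)"
    by (intro cong_mult cong_sym[OF E])
  finally show "[Legendre (a * b) (int p) = Legendre a (int p) * Legendre b (int p)] (mod int p)" .
  show "Legendre a (int p) * Legendre b (int p) \<in> {-1, 0, 1}"
    using Legendre_cases[of a "int p"] Legendre_cases[of b "int p"] by auto
qed (use p(2) Legendre_cases in simp_all)

lemma Legendre_minus_one:
  assumes p: "prime (p::nat)" "p > 2"
  shows "Legendre (- 1) (int p) = (if p mod 4 = 1 then 1 else - 1)"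
proof -
  have "odd p" using p prime_odd_nat by blast
  then have par: "even ((p - 1) div 2) \<longleftrightarrow> p mod 4 = 1" by presburger
  then have e: "(- 1 :: int) ^ ((p - 1) div 2) = (if p mod 4 = 1 then 1 else - 1)" by simp
  show ?thesis
  proof (rule Legendre_eqI)
    show "[Legendre (- 1) (int p) = (if p mod 4 = 1 then 1 else - 1)] (mod int p)"
      using euler_criterion[OF p, of "- 1"] unfolding e .
  qed (use p Legendre_cases[of "- 1" "int p"] in simp_all)
qed

text \<open>
  A primitive root is a nonresidue by Euler's criterion, and adding the odd number \<open>p\<close>
  corrects its parity.
\<close>
lemma exists_odd_nonresidue:
  fixes p :: nat
  assumes p: "prime p" "p > 2"
  shows "\<exists>u. odd u \<and> Legendre (int u) (int p) = -1"
proof -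
  obtain x where x: "residue_primroot p x"
    using prime_primitive_root_exists[of p] p by auto
  have "odd p" using p prime_odd_nat by blast
  have "ord p x = p - 1" "coprime p x"
    using x p by (auto simp: residue_primroot_def totient_prime)
  then have "\<not> [x ^ ((p - 1) div 2) = 1] (mod p)"
    using p \<open>odd p\<close> by (intro ord_minimal) auto
  then have "\<not> [int x ^ ((p - 1) div 2) = 1] (mod int p)"
    by (metis cong_int_iff of_nat_1 of_nat_power)
  then have "Legendre (int x) (int p) \<noteq> 1"
    using euler_criterion[OF p, of "int x"] by (metis cong_sym)
  moreover have "Legendre (int x) (int p) \<noteq> 0"
  proof -
    have "\<not> p dvd x" using \<open>coprime p x\<close> p by (metis coprime_common_divisor_nat dvd_refl less_irrefl_nat prime_gt_1_nat)
    then show ?thesis by (simp add: Legendre_def cong_0_iff)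
  qed
  ultimately have L: "Legendre (int x) (int p) = -1"
    using Legendre_cases[of "int x" "int p"] by auto
  have "Legendre (int (x + p)) (int p) = Legendre (int x) (int p)"
    by (rule Legendre_cong) (simp add: cong_def)
  then show ?thesis
    using L \<open>odd p\<close> by (cases "odd x") (auto intro: exI[of _ x] exI[of _ "x + p"])
qed

text \<open>
  The nonprincipal Dirichlet character modulo 4.
\<close>
definition chi4 :: "nat \<Rightarrow> real" where
  "chi4 n = (if n mod 4 = 1 then 1 else if n mod 4 = 3 then -1 else 0)"

lemma chi4_mod: "chi4 (n mod 4) = chi4 n"
  by (simp add: chi4_def)

lemma chi4_mult: "chi4 (a * b) = chi4 a * chi4 b"
proof -
  have "\<forall>r\<in>{0::nat, 1, 2, 3}. \<forall>s\<in>{0::nat, 1, 2, 3}. chi4 (r * s) = chi4 r * chi4 s"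
    by (simp add: chi4_def)
  moreover have "a mod 4 \<in> {0, 1, 2, 3}" "b mod 4 \<in> {0, 1, 2, 3}"
    by auto
  ultimately have "chi4 ((a mod 4) * (b mod 4)) = chi4 (a mod 4) * chi4 (b mod 4)"
    by (meson bspec)
  then show ?thesis
    by (metis chi4_mod mod_mult_eq)
qed

lemma chi4_0: "chi4 0 = 0" and chi4_1: "chi4 1 = 1"
  by (simp_all add: chi4_def)

lemma chi4_odd: "odd n \<Longrightarrow> chi4 n \<noteq> 0"
proof -
  assume "odd n"
  then have "n mod 4 = 1 \<or> n mod 4 = 3" by presburger
  then show ?thesis by (auto simp: chi4_def)
qed

text \<open>
  The quadratic character modulo \<open>p\<close>, made to vanish at even numbers. At the prime 2, where
  \<open>chi4\<close> vanishes, a value \<open>-1\<close> would make 2 itself a prime at which the two characters have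
  negative sum; with the value 0 this cannot happen.
\<close>
definition odd_Legendre :: "nat \<Rightarrow> nat \<Rightarrow> real" where
  "odd_Legendre p n = (if even n then 0 else of_int (Legendre (int n) (int p)))"

text \<open>
  Apply \<open>exists_prime_negative_for_both\<close> to the character modulo 4 and the quadratic character
  modulo \<open>p\<close>. A negative sum of two values in \<open>{-1, 0, 1}\<close> means that both are \<open>-1\<close> or one
  is \<open>-1\<close> and the other 0. The latter is excluded: among primes the characters vanish only
  at 2, where both do, and at \<open>p\<close>, where the first is \<open>1\<close> since \<open>p\<close> is 1 modulo 4.
\<close>
theorem exists_prime_3_mod_4_nonresidue:
  fixes p :: nat
  assumes p: "prime p" "p mod 4 = 1"
  shows "\<exists>q. prime q \<and> q mod 4 = 3 \<and> Legendre (int q) (int p) = -1"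
proof -
  have p2: "p > 2" using p prime_ge_2_nat[of p] by (cases "p = 2") auto
  let ?h = "odd_Legendre p"
  have h_per: "?h (n mod (2 * p)) = ?h n" for n
  proof -
    have "[int (n mod (2 * p)) = int n] (mod int p)"
      by (metis cong_int_iff cong_mod_left cong_modulus_mult_nat cong_refl mult.commute)
    then show ?thesis
      using Legendre_cong by (simp add: odd_Legendre_def dvd_mod_iff)
  qed
  have h_mult: "?h (a * b) = ?h a * ?h b" for a b
    using Legendre_mult[OF p(1) p2] by (simp add: odd_Legendre_def)
  have h_cases: "?h n \<in> {-1, 0, 1}" for n
    using Legendre_cases[of "int n" "int p"] by (auto simp: odd_Legendre_def)
  have "Legendre 1 (int p) = 1"
  proof -
    have "\<not> int p dvd 1" using p2 by simp
    then show ?thesis by (auto simp: Legendre_def QuadRes_def cong_0_iff intro: exI[of _ 1])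
  qed
  then have h_1: "?h 1 = 1" by (simp add: odd_Legendre_def)
  obtain u where u: "odd u" "Legendre (int u) (int p) = -1"
    using exists_odd_nonresidue[OF p(1) p2] by blast
  have "\<not> p dvd u" using u by (auto simp: Legendre_def cong_0_iff)
  then have "coprime u (2 * p)" using u p by (simp add: coprime_commute prime_imp_coprime)
  then have h_zero: "(\<Sum>n<2 * p. ?h n) = 0"
    using u p2 by (intro periodic_sum_zero[OF h_per h_mult]) (auto simp: odd_Legendre_def)
  have g_zero: "(\<Sum>n<4. chi4 n) = 0"
  proof -
    have "{..<4::nat} = {0, 1, 2, 3}" by auto
    then show ?thesis by (simp add: chi4_def)
  qed
  have g_cases: "chi4 n \<in> {-1, 0, 1}" for n by (auto simp: chi4_def)
  have abs: "\<bar>chi4 n\<bar> \<le> 1" "\<bar>?h n\<bar> \<le> 1" for n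
    using g_cases[of n] h_cases[of n] by auto
  have bound_g: "\<bar>\<Sum>n=1..k. chi4 n\<bar> \<le> real (2 * p)" for k
    using periodic_partial_sum_bound[OF chi4_mod g_zero abs(1) chi4_0, of k] p2 by simp
  have bound_h: "\<bar>\<Sum>n=1..k. ?h n\<bar> \<le> real (2 * p)" for k
    using p2 by (intro periodic_partial_sum_bound[OF h_per h_zero abs(2)]) (auto simp: odd_Legendre_def)
  have supp: "chi4 q \<noteq> 0 \<or> ?h q \<noteq> 0" if "prime q" "q \<noteq> 2" for q
    using that chi4_odd primes_dvd_imp_eq[OF two_is_prime_nat, of q] by blast
  obtain q where q: "prime q" "chi4 q + ?h q < 0"
    using exists_prime_negative_for_both[OF chi4_mult chi4_1 g_cases h_mult h_1 h_cases bound_g bound_h supp]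
    by blast
  have "?h q \<noteq> 0"
  proof
    assume 0: "?h q = 0"
    then have "chi4 q \<noteq> 0" "chi4 q \<noteq> 1" using q by auto
    then have q3: "q mod 4 = 3" by (auto simp: chi4_def split: if_splits)
    then have "odd q" by presburger
    with 0 have "p dvd q" by (auto simp: odd_Legendre_def Legendre_def cong_0_iff split: if_splits)
    then have "p = q" using p q by (simp add: primes_dvd_imp_eq)
    then show False using q3 p by simp
  qed
  moreover from this have "chi4 q \<noteq> 0"
    by (intro chi4_odd) (auto simp: odd_Legendre_def)
  ultimately have "chi4 q = -1" "?h q = -1"
    using q g_cases[of q] h_cases[of q] by auto
  then show ?thesis
    using q(1) by (auto simp: chi4_def odd_Legendre_def split: if_splits intro!: exI[of _ q])
qed

section \<open>Isotropy over the completions\<close>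

lemma (in ring_hom_ring) hom_add_pow:
  "x \<in> carrier R \<Longrightarrow> h ([(n::nat)] \<cdot>\<^bsub>R\<^esub> x) = [n] \<cdot>\<^bsub>S\<^esub> h x"
  by (induction n) auto

lemma (in ring_hom_ring) hom_eval_form:
  assumes "x \<in> carrier R" "y \<in> carrier R" "z \<in> carrier R"
  shows "h (eval_form R Q x y z) = eval_form S Q (h x) (h y) (h z)"
  using assms by (cases Q) (simp add: hom_add_pow numeral_2_eq_2)

lemma eval_form_padic_Cauchy_ring:
  "eval_form (padic_Cauchy_ring p) \<langle>a, b, c\<rangle> x y z =
    (\<lambda>n. of_nat a * x n ^ 2 + of_nat b * y n ^ 2 + of_nat c * z n ^ 2)"
proof -
  have sq: "x [^]\<^bsub>padic_Cauchy_ring p\<^esub> (2::nat) = (\<lambda>n. x n ^ 2)" for x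
    by (simp add: nat_pow_def numeral_2_eq_2 padic_Cauchy_ring_def)
  have scale: "[a] \<cdot>\<^bsub>padic_Cauchy_ring p\<^esub> x = (\<lambda>n. of_nat a * x n)" for a x
    by (induction a) (simp_all add: add_pow_def nat_pow_def padic_Cauchy_ring_def algebra_simps)
  show ?thesis
    by (simp add: sq scale) (simp add: padic_Cauchy_ring_def)
qed

lemma carrier_Qp:
  "carrier (Qp p) =
    (\<lambda>x. {s. padic_null p s} +>\<^bsub>padic_Cauchy_ring p\<^esub> x) ` carrier (padic_Cauchy_ring p)"
  unfolding Qp_def FactRing_def A_RCOSETS_def' by (simp add: image_def) blast

lemma zero_Qp: "\<zero>\<^bsub>Qp p\<^esub> = {s. padic_null p s}"
  by (simp add: Qp_def FactRing_def)

text \<open>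
  Isotropy over the completion in terms of representing Cauchy sequences: a coset is zero
  exactly when its representative is a null sequence, and the quotient map commutes with
  evaluation of the form.
\<close>
lemma isotropic_at_Fin_place_iff:
  assumes p: "prime p"
  shows "isotropic_at (Fin_place p) \<langle>a, b, c\<rangle> \<longleftrightarrow>
    (\<exists>x y z. padic_Cauchy p x \<and> padic_Cauchy p y \<and> padic_Cauchy p z \<and>
       \<not> (padic_null p x \<and> padic_null p y \<and> padic_null p z) \<and>
       padic_null p (\<lambda>n. of_nat a * x n ^ 2 + of_nat b * y n ^ 2 + of_nat c * z n ^ 2))"
proof -
  let ?R = "padic_Cauchy_ring p" and ?I = "{s. padic_null p s}"
  interpret R: cring ?R by (rule cring_padic_Cauchy_ring[OF p])
  interpret I: ideal ?I ?R by (rule ideal_padic_null[OF p])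
  interpret h: ring_hom_ring ?R "Qp p" "(+>\<^bsub>?R\<^esub>) ?I"
    unfolding Qp_def by (rule I.rcos_ring_hom_ring)
  have zero: "?I +>\<^bsub>?R\<^esub> x = \<zero>\<^bsub>Qp p\<^esub> \<longleftrightarrow> padic_null p x" if "x \<in> carrier ?R" for x
    unfolding zero_Qp using I.a_rcos_self[OF that] I.a_rcos_const[of x] by (metis mem_Collect_eq)
  have memb: "x \<in> carrier ?R \<longleftrightarrow> padic_Cauchy p x" for x
    by (simp add: padic_Cauchy_ring_def)
  have eval: "eval_form (Qp p) \<langle>a, b, c\<rangle> (?I +>\<^bsub>?R\<^esub> x) (?I +>\<^bsub>?R\<^esub> y) (?I +>\<^bsub>?R\<^esub> z) = \<zero>\<^bsub>Qp p\<^esub> \<longleftrightarrow>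
      padic_null p (\<lambda>n. of_nat a * x n ^ 2 + of_nat b * y n ^ 2 + of_nat c * z n ^ 2)"
    if "x \<in> carrier ?R" "y \<in> carrier ?R" "z \<in> carrier ?R" for x y z
  proof -
    have "eval_form ?R \<langle>a, b, c\<rangle> x y z \<in> carrier ?R"
      unfolding eval_form.simps by (intro R.add.m_closed R.add.nat_pow_closed R.nat_pow_closed that)
    from zero[OF this] show ?thesis
      unfolding h.hom_eval_form[OF that] unfolding eval_form_padic_Cauchy_ring .
  qed
  have "isotropic_at (Fin_place p) \<langle>a, b, c\<rangle> \<longleftrightarrow>
    (\<exists>x\<in>carrier ?R. \<exists>y\<in>carrier ?R. \<exists>z\<in>carrier ?R.
       \<not> (?I +>\<^bsub>?R\<^esub> x = \<zero>\<^bsub>Qp p\<^esub> \<and> ?I +>\<^bsub>?R\<^esub> y = \<zero>\<^bsub>Qp p\<^esub> \<and> ?I +>\<^bsub>?R\<^esub> z = \<zero>\<^bsub>Qp p\<^esub>) \<and>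
       eval_form (Qp p) \<langle>a, b, c\<rangle> (?I +>\<^bsub>?R\<^esub> x) (?I +>\<^bsub>?R\<^esub> y) (?I +>\<^bsub>?R\<^esub> z) = \<zero>\<^bsub>Qp p\<^esub>)"
    unfolding isotropic_at.simps isotropic_over_def carrier_Qp by blast
  also have "\<dots> \<longleftrightarrow> (\<exists>x\<in>carrier ?R. \<exists>y\<in>carrier ?R. \<exists>z\<in>carrier ?R.
       \<not> (padic_null p x \<and> padic_null p y \<and> padic_null p z) \<and>
       padic_null p (\<lambda>n. of_nat a * x n ^ 2 + of_nat b * y n ^ 2 + of_nat c * z n ^ 2))"
    by (intro bex_cong refl) (simp only: zero eval)
  finally show ?thesis
    unfolding Bex_def memb by blast
qed

lemma isotropic_at_Inf_place_iff:
  "isotropic_at Inf_place \<langle>a, b, c\<rangle> \<longleftrightarrow>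
    (\<exists>x y z :: real. \<not> (x = 0 \<and> y = 0 \<and> z = 0) \<and> real a * x ^ 2 + real b * y ^ 2 + real c * z ^ 2 = 0)"
proof -
  let ?R = "ring_of_type_algebra :: real ring"
  have sq: "x [^]\<^bsub>?R\<^esub> (2::nat) = x ^ 2" for x
    by (simp add: nat_pow_def numeral_2_eq_2 ring_of_type_algebra_def)
  have scale: "[a] \<cdot>\<^bsub>?R\<^esub> x = real a * x" for a x
    by (induction a) (simp_all add: add_pow_def nat_pow_def ring_of_type_algebra_def algebra_simps)
  show ?thesis
    by (simp add: isotropic_over_def sq scale) (simp add: ring_of_type_algebra_def)
qed

lemma anisotropic_at_Inf_place:
  assumes "a > 0" "b > 0" "c > 0"
  shows "anisotropic_at Inf_place \<langle>a, b, c\<rangle>"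
  unfolding isotropic_at_Inf_place_iff
proof clarify
  fix x y z :: real
  assume eq: "real a * x ^ 2 + real b * y ^ 2 + real c * z ^ 2 = 0"
    and nz: "\<not> (x = 0 \<and> y = 0 \<and> z = 0)"
  have nonneg: "real a * x ^ 2 \<ge> 0" "real b * y ^ 2 \<ge> 0" "real c * z ^ 2 \<ge> 0" by simp_all
  then have "real a * x ^ 2 = 0" "real b * y ^ 2 = 0" "real c * z ^ 2 = 0"
    using eq by linarith+
  with assms nz show False by simp
qed

text \<open>
  The bridge between the metric and divisibility: for integers, closeness to 0 is
  divisibility by powers of \<open>p\<close>.
\<close>
lemma padic_abs_of_int_le_iff:
  assumes p: "prime p"
  shows "padic_abs p (of_int m) \<le> 1 / real p ^ k \<longleftrightarrow> int p ^ k dvd m"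
proof (cases "m = 0")
  case False
  have p1: "real p > 1" using prime_gt_1_nat[OF p] by simp
  define v where "v = Factorial_Ring.multiplicity (int p) m"
  have "padic_val p (of_int m) = int v"
    by (simp add: padic_val_def v_def)
  then have "padic_abs p (of_int m) = 1 / real p ^ v"
    using False by (simp add: padic_abs_def power_int_minus inverse_eq_divide)
  also have "\<dots> \<le> 1 / real p ^ k \<longleftrightarrow> k \<le> v"
    using p1 by (simp add: divide_le_cancel frac_le_eq field_simps)
  also have "\<dots> \<longleftrightarrow> int p ^ k dvd m"
    unfolding v_def using False p by (subst power_dvd_iff_le_multiplicity) (auto simp: prime_nat_iff)
  finally show ?thesis .
qed (use p in simp)

lemma padic_null_of_int:
  assumes p: "prime p" and u: "\<And>n. int p ^ n dvd u n"
  shows "padic_null p (\<lambda>n. of_int (u n))"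
proof -
  have "(\<lambda>n. 1 / real p ^ n) \<longlonglongrightarrow> 0"
    using LIMSEQ_inverse_realpow_zero[of "real p"] prime_gt_1_nat[OF p] by (simp add: inverse_eq_divide)
  then show ?thesis
    unfolding padic_null_def
    by (rule tendsto_sandwich[OF _ _ tendsto_const, rotated 2])
       (auto intro!: always_eventually simp: p padic_abs_nonneg padic_abs_of_int_le_iff u)
qed

lemma padic_Cauchy_of_int:
  assumes p: "prime p" and u: "\<And>n. int p ^ n dvd u (Suc n) - u n"
  shows "padic_Cauchy p (\<lambda>n. of_int (u n))"
  unfolding padic_Cauchy_def
proof (intro allI impI)
  fix e :: real assume e: "e > 0"
  have "(\<lambda>n. 1 / real p ^ n) \<longlonglongrightarrow> 0"
    using LIMSEQ_inverse_realpow_zero[of "real p"] prime_gt_1_nat[OF p] by (simp add: inverse_eq_divide)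
  then obtain N where N: "1 / real p ^ N < e"
    using e by (metis (no_types, lifting) eventually_sequentially order_refl order_tendstoD(2))
  have dvd: "int p ^ N dvd u n - u N" if "n \<ge> N" for n
    using that
  proof (induction n rule: dec_induct)
    case (step n)
    have "int p ^ N dvd u (Suc n) - u n"
      using u[of n] le_imp_power_dvd[OF step(1)] dvd_trans by blast
    from dvd_add[OF this step(3)] show ?case by simp
  qed simp
  have "padic_abs p (of_int (u m) - of_int (u n)) < e" if "m \<ge> N" "n \<ge> N" for m n
  proof -
    have "int p ^ N dvd u m - u n"
      using dvd_diff[OF dvd[OF that(1)] dvd[OF that(2)]] by simp
    then have "padic_abs p (of_int (u m - u n)) \<le> 1 / real p ^ N"
      by (simp only: padic_abs_of_int_le_iff[OF p])
    then show ?thesis using N by simp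
  qed
  then show "\<exists>N. \<forall>m\<ge>N. \<forall>n\<ge>N. padic_abs p (of_int (u m) - of_int (u n)) < e" by blast
qed

text \<open>
  A coherent sequence of integer solutions modulo \<open>p ^ n\<close> is a zero of the form over the
  completion. The constant nonzero third coordinate guarantees that the zero is nontrivial.
\<close>
lemma isotropic_at_Fin_placeI:
  fixes u v :: "nat \<Rightarrow> int" and z :: int
  assumes p: "prime p"
    and u: "\<And>n. int p ^ n dvd u (Suc n) - u n" and v: "\<And>n. int p ^ n dvd v (Suc n) - v n"
    and F: "\<And>n. int p ^ n dvd int a * u n ^ 2 + int b * v n ^ 2 + int c * z ^ 2" and z: "z \<noteq> 0"
  shows "isotropic_at (Fin_place p) \<langle>a, b, c\<rangle>"
  unfolding isotropic_at_Fin_place_iff[OF p]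
proof (intro exI conjI)
  show "padic_Cauchy p (\<lambda>n. of_int (u n))" "padic_Cauchy p (\<lambda>n. of_int (v n))"
    using padic_Cauchy_of_int[OF p] u v by blast+
  show "padic_Cauchy p (\<lambda>n. of_int z)" by (rule padic_Cauchy_const[OF p])
  have "\<not> padic_null p (\<lambda>n. of_int z)"
    using z p by (simp add: padic_null_def LIMSEQ_const_iff padic_abs_eq_0_iff)
  then show "\<not> (padic_null p (\<lambda>n. of_int (u n)) \<and> padic_null p (\<lambda>n. of_int (v n)) \<and> padic_null p (\<lambda>n. of_int z))"
    by blast
  show "padic_null p (\<lambda>n. of_nat a * of_int (u n) ^ 2 + of_nat b * of_int (v n) ^ 2 + of_nat c * of_int z ^ 2)"
    using padic_null_of_int[OF p F] by simp
qed

text \<open>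
  Clear denominators and divide by the greatest common divisor.
\<close>
lemma rat_triple_primitive:
  fixes r s t :: rat
  assumes p: "prime (p::nat)" and nz: "\<not> (r = 0 \<and> s = 0 \<and> t = 0)"
  obtains l :: rat and x y z :: int where "r = l * of_int x" "s = l * of_int y" "t = l * of_int z"
    "\<not> (int p dvd x \<and> int p dvd y \<and> int p dvd z)"
proof -
  have frac: "\<exists>a d. q = of_int a / of_int d \<and> d > 0" for q :: rat
    using quotient_of_div[of q] quotient_of_denom_pos[of q] by (cases "quotient_of q") blast
  obtain a1 d1 where r: "r = of_int a1 / of_int d1" "d1 > 0" using frac by blast
  obtain a2 d2 where s: "s = of_int a2 / of_int d2" "d2 > 0" using frac by blast
  obtain a3 d3 where t: "t = of_int a3 / of_int d3" "d3 > 0" using frac by blast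
  define x y z where "x = a1 * d2 * d3" and "y = a2 * d1 * d3" and "z = a3 * d1 * d2"
  define g where "g = gcd x (gcd y z)"
  define l :: rat where "l = of_int g / of_int (d1 * d2 * d3)"
  have g: "g dvd x" "g dvd y" "g dvd z"
    unfolding g_def by (meson gcd_dvd1 gcd_dvd2 dvd_trans)+
  have "g \<noteq> 0"
    using nz r s t by (auto simp: g_def x_def y_def z_def)
  then have gm: "of_int g * (of_int (m div g) :: rat) = of_int m" if "g dvd m" for m
    using that by (metis dvd_mult_div_cancel of_int_mult)
  show thesis
  proof (rule that[of l "x div g" "y div g" "z div g"])
    have l: "l * of_int (m div g) = of_int m / of_int (d1 * d2 * d3)" if "g dvd m" for m
      using gm[OF that] by (simp add: l_def)
    show "r = l * of_int (x div g)" "s = l * of_int (y div g)" "t = l * of_int (z div g)"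
      unfolding l[OF g(1)] l[OF g(2)] l[OF g(3)] using r s t by (simp_all add: x_def y_def z_def)
    show "\<not> (int p dvd x div g \<and> int p dvd y div g \<and> int p dvd z div g)"
    proof
      assume "int p dvd x div g \<and> int p dvd y div g \<and> int p dvd z div g"
      then have "int p * g dvd x" "int p * g dvd y" "int p * g dvd z"
        using g by (metis dvd_div_iff_mult mult_dvd_mono dvd_refl dvd_mult_div_cancel mult.commute)+
      then have "int p * g dvd 1 * g" by (simp add: g_def)
      then have "int p dvd 1" using \<open>g \<noteq> 0\<close> by (simp only: dvd_mult_cancel_right) auto
      then show False using p by (simp add: prime_nat_iff)
    qed
  qed
qed

text \<open>
  Anisotropy is proved by congruences: some term of a nontrivial zero approximates it so
  well that, after scaling to a primitive integer triple, the form is divisible by \<open>p ^ k\<close>.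
  Scaling is harmless since one of the coordinates stays away from 0.
\<close>
lemma isotropic_at_Fin_place_imp_primitive_zero:
  assumes p: "prime p" and iso: "isotropic_at (Fin_place p) \<langle>a, b, c\<rangle>"
  obtains x y z :: int where "\<not> (int p dvd x \<and> int p dvd y \<and> int p dvd z)"
    "int p ^ k dvd int a * x ^ 2 + int b * y ^ 2 + int c * z ^ 2"
proof -
  define F :: "rat \<Rightarrow> rat \<Rightarrow> rat \<Rightarrow> rat" where "F r s t = of_nat a * r ^ 2 + of_nat b * s ^ 2 + of_nat c * t ^ 2" for r s t
  obtain u v w where nn: "\<not> (padic_null p u \<and> padic_null p v \<and> padic_null p w)"
    and null: "padic_null p (\<lambda>n. F (u n) (v n) (w n))"
    using iso unfolding isotropic_at_Fin_place_iff[OF p] F_def by blast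
  obtain f where f: "f \<in> {u, v, w}" "\<not> padic_null p f" using nn by blast
  obtain e where e: "e > 0" and far: "\<And>N. \<exists>n\<ge>N. padic_abs p (f n) \<ge> e"
    using f(2) unfolding padic_null_iff[OF p] by (metis not_less)
  have p0: "real p > 0" using prime_gt_0_nat[OF p] by simp
  then have "e * e / real p ^ k > 0" using e by simp
  then obtain N where N: "\<And>n. n \<ge> N \<Longrightarrow> padic_abs p (F (u n) (v n) (w n)) < e * e / real p ^ k"
    using null unfolding padic_null_iff[OF p] by blast
  obtain n where n: "n \<ge> N" "padic_abs p (f n) \<ge> e" using far by blast
  define r s t where "r = u n" and "s = v n" and "t = w n"
  have fn: "f n \<in> {r, s, t}" using f(1) by (auto simp: r_def s_def t_def)
  have "f n \<noteq> 0" using n(2) e p by (auto simp: padic_abs_zero)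
  then have "\<not> (r = 0 \<and> s = 0 \<and> t = 0)" using fn by auto
  then obtain l x y z where rst: "r = l * of_int x" "s = l * of_int y" "t = l * of_int z"
    and prim: "\<not> (int p dvd x \<and> int p dvd y \<and> int p dvd z)"
    using rat_triple_primitive[OF p] by metis
  have le1: "padic_abs p (of_int m) \<le> 1" for m
    using padic_abs_of_int_le_iff[OF p, of m 0] by simp
  obtain m where "f n = l * of_int m" using fn rst by auto
  then have "padic_abs p (f n) = padic_abs p l * padic_abs p (of_int m)"
    by (simp add: padic_abs_mult[OF p])
  also have "\<dots> \<le> padic_abs p l * 1"
    by (intro mult_left_mono le1 padic_abs_nonneg[OF p])
  finally have l: "e \<le> padic_abs p l" using n(2) by simp
  define G where "G = int a * x ^ 2 + int b * y ^ 2 + int c * z ^ 2"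
  \<comment> \<open>The bound \<open>e * e / p ^ k\<close> chosen for the form absorbs the factor \<open>l * l\<close>, which is at least \<open>e * e\<close>.\<close>
  have "F r s t = l * l * of_int G"
    by (simp add: F_def G_def rst power2_eq_square algebra_simps)
  then have "padic_abs p l * padic_abs p l * padic_abs p (of_int G) < e * e / real p ^ k"
    using N[OF n(1)] by (simp add: r_def s_def t_def padic_abs_mult[OF p])
  moreover have "e * e * padic_abs p (of_int G) \<le> padic_abs p l * padic_abs p l * padic_abs p (of_int G)"
    using l e by (intro mult_right_mono mult_mono) (auto simp: padic_abs_nonneg[OF p])
  ultimately have "e * e * padic_abs p (of_int G) < e * e * (1 / real p ^ k)" by simp
  then have "padic_abs p (of_int G) \<le> 1 / real p ^ k"
    using e by (simp only: mult_less_cancel_left_pos mult_pos_pos)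
  then have "int p ^ k dvd G" by (simp only: padic_abs_of_int_le_iff[OF p])
  then show thesis using that prim by (simp add: G_def)
qed

section \<open>Square roots of integers in the p-adic integers\<close>

text \<open>
  Hensel's lemma for \<open>X ^ 2 - A\<close>. The exponent \<open>e\<close> is the exact power of \<open>l\<close> in the
  derivative \<open>2 * x0\<close>; odd primes use \<open>e = 0\<close>, and the prime 2 uses \<open>e = 1\<close>.
\<close>
lemma square_root_lift:
  fixes A x0 w :: int
  assumes l: "prime (l::nat)" and x0: "int l ^ (2 * e + 1) dvd x0 ^ 2 - A"
    and w: "2 * x0 = int l ^ e * w" "\<not> int l dvd w"
  obtains u :: "nat \<Rightarrow> int" where "\<And>n. int l ^ n dvd u (Suc n) - u n" "\<And>n. int l ^ n dvd u n ^ 2 - A"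
proof -
  define P where "P n x \<longleftrightarrow> int l ^ (n + 1 + 2 * e) dvd x ^ 2 - A \<and> (\<exists>w. 2 * x = int l ^ e * w \<and> \<not> int l dvd w)"
    for n and x :: int
  have "\<exists>u. \<forall>n. P n (u n) \<and> int l ^ n dvd u (Suc n) - u n"
  proof (rule dependent_nat_choice)
    show "\<exists>x. P 0 x"
      unfolding P_def by (intro exI[of _ x0] conjI exI[of _ w]) (use x0 w in simp_all)
  next
    fix x n assume "P n x"
    then obtain c w where c: "x ^ 2 - A = int l ^ (n + 1 + 2 * e) * c"
      and w: "2 * x = int l ^ e * w" "\<not> int l dvd w"
      by (auto simp: P_def dvd_def)
    have "coprime (int l) w" using w(2) l by (intro prime_imp_coprime) simp_all
    then have "coprime w (int l)" by (rule coprime_commute[THEN iffD1])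
    then obtain w' where w': "[w * w' = 1] (mod int l)"
      using cong_solve_coprime_int by blast
    \<comment> \<open>The Newton correction: it solves \<open>c + w * t = 0\<close> modulo \<open>l\<close>.\<close>
    define t where "t = - (c * w')"
    define y where "y = x + int l ^ (n + 1 + e) * t"
    have "int l dvd - c * (w * w' - 1)"
      using w' by (simp only: cong_iff_dvd_diff dvd_mult)
    then have t: "int l dvd c + w * t" by (simp add: t_def algebra_simps)
    have "y ^ 2 - A = (x ^ 2 - A) + 2 * x * int l ^ (n + 1 + e) * t + int l ^ (n + 1 + e) * int l ^ (n + 1 + e) * t ^ 2"
      by (simp add: y_def power2_eq_square algebra_simps)
    also have "\<dots> = int l ^ (n + 1 + 2 * e) * (c + w * t + int l * (int l ^ n * t ^ 2))"
    proof -
      have pow: "int l ^ (n + 1 + e) = int l * int l ^ n * int l ^ e"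
        "int l ^ (n + 1 + 2 * e) = int l * int l ^ n * int l ^ e * int l ^ e"
        by (simp_all add: power_add mult_2)
      show ?thesis unfolding c w(1) pow by (simp add: power2_eq_square algebra_simps)
    qed
    finally have y: "y ^ 2 - A = int l ^ (n + 1 + 2 * e) * (c + w * t + int l * (int l ^ n * t ^ 2))" .
    have "int l dvd c + w * t + int l * (int l ^ n * t ^ 2)"
      using t by simp
    then have "int l ^ (n + 1 + 2 * e) * int l dvd y ^ 2 - A"
      unfolding y by (intro mult_dvd_mono) auto
    moreover have "2 * y = int l ^ e * (w + int l * (2 * int l ^ n * t))"
      using w(1) by (simp add: y_def power_add algebra_simps)
    moreover have "\<not> int l dvd w + int l * (2 * int l ^ n * t)"
      using w(2) by (simp add: dvd_add_left_iff)
    ultimately have "P (Suc n) y"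
      by (auto simp: P_def mult.commute)
    moreover have "int l ^ n dvd y - x"
      by (simp add: y_def power_add)
    ultimately show "\<exists>y. P (Suc n) y \<and> int l ^ n dvd y - x" by blast
  qed
  then obtain u where u: "\<And>n. P n (u n)" "\<And>n. int l ^ n dvd u (Suc n) - u n" by blast
  have "int l ^ n dvd u n ^ 2 - A" for n
  proof -
    have "int l ^ n dvd int l ^ (n + 1 + 2 * e)" by (rule le_imp_power_dvd) simp
    with u(1) show ?thesis unfolding P_def using dvd_trans by blast
  qed
  then show thesis using u(2) that by blast
qed

lemma square_root_lift_odd:
  assumes l: "prime (l::nat)" "l \<noteq> 2" and x0: "int l dvd x0 ^ 2 - A" "\<not> int l dvd A"
  obtains u :: "nat \<Rightarrow> int" where "\<And>n. int l ^ n dvd u (Suc n) - u n" "\<And>n. int l ^ n dvd u n ^ 2 - A"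
proof (rule square_root_lift[OF l(1), of 0 x0 A "2 * x0"])
  have pl: "prime (int l)" using l by simp
  have "\<not> int l dvd 2" using l by (metis of_nat_dvd_iff of_nat_numeral primes_dvd_imp_eq two_is_prime_nat)
  moreover have "\<not> int l dvd x0"
  proof
    assume "int l dvd x0"
    then have "int l dvd x0 ^ 2" by (simp add: power2_eq_square)
    from dvd_diff[OF this x0(1)] have "int l dvd A" by simp
    with x0(2) show False by simp
  qed
  ultimately show "\<not> int l dvd 2 * x0" using pl by (simp add: prime_dvd_mult_iff)
qed (use x0 that in auto)

text \<open>
  The starting value is 1, whose derivative \<open>2 * 1\<close> contains exactly one factor 2, so that a
  congruence modulo \<open>2 ^ 3\<close> suffices.
\<close>
lemma square_root_lift_2:
  assumes "8 dvd 1 - A"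
  obtains u :: "nat \<Rightarrow> int" where "\<And>n. int 2 ^ n dvd u (Suc n) - u n" "\<And>n. int 2 ^ n dvd u n ^ 2 - A"
  by (rule square_root_lift[of 2 1 1 A 1]) (use assms that in auto)

text \<open>
  Pigeonhole: each of \<open>x ^ 2\<close> and \<open>- c - b * y ^ 2\<close> takes \<open>(l + 1) / 2\<close> distinct values
  modulo \<open>l\<close> for \<open>x\<close>, \<open>y\<close> between 0 and \<open>(l - 1) / 2\<close>, and together these are more than \<open>l\<close>
  values.
\<close>
lemma exists_zero_mod_odd_prime:
  fixes b c :: int
  assumes l: "prime (l::nat)" "l \<noteq> 2" and b: "\<not> int l dvd b"
  shows "\<exists>x y. int l dvd x ^ 2 + b * y ^ 2 + c"
proof -
  define S where "S = {0..(int l - 1) div 2}"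
  have pl: "prime (int l)" using l by simp
  have "l > 2" using l prime_ge_2_nat[of l] by simp
  have "odd l" using l prime_odd_nat[of l] \<open>l > 2\<close> by blast
  \<comment> \<open>Two representatives between 0 and \<open>(l - 1) / 2\<close> are congruent up to sign only if they are equal.\<close>
  have sq_inj: "x = y" if "x \<in> S" "y \<in> S" "int l dvd x ^ 2 - y ^ 2" for x y
  proof -
    have "int l dvd (x - y) * (x + y)"
      using that(3) by (simp add: power2_eq_square algebra_simps)
    then consider "int l dvd x - y" | "int l dvd x + y" using pl by (auto simp: prime_dvd_mult_iff)
    then show ?thesis
    proof cases
      case 1
      have "\<bar>x - y\<bar> < int l" using that(1,2) by (auto simp: S_def)
      with 1 show ?thesis using zdvd_imp_le[of "int l" "\<bar>x - y\<bar>"] by (cases "x = y") auto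
    next
      case 2
      have "0 \<le> x + y" "x + y < int l" using that(1,2) \<open>l > 2\<close> by (auto simp: S_def)
      with 2 have "x + y = 0" using zdvd_not_zless[of "x + y" "int l"] by linarith
      then show ?thesis using that(1,2) by (auto simp: S_def)
    qed
  qed
  define f g where "f x = x ^ 2 mod int l" and "g y = (- c - b * y ^ 2) mod int l" for x y :: int
  have f: "inj_on f S"
    by (rule inj_onI) (auto simp: f_def mod_eq_dvd_iff intro: sq_inj)
  have g: "inj_on g S"
  proof (rule inj_onI)
    fix x y assume xy: "x \<in> S" "y \<in> S" "g x = g y"
    then have "int l dvd b * (y ^ 2 - x ^ 2)"
      by (simp add: g_def mod_eq_dvd_iff algebra_simps)
    then have "int l dvd y ^ 2 - x ^ 2" using pl b by (simp add: prime_dvd_mult_iff)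
    then show "x = y" using sq_inj xy by metis
  qed
  have "f ` S \<inter> g ` S \<noteq> {}"
  proof
    assume disj: "f ` S \<inter> g ` S = {}"
    have "card (f ` S \<union> g ` S) = card S + card S"
      using disj f g by (subst card_Un_disjoint) (auto simp: card_image S_def)
    moreover have "card (f ` S \<union> g ` S) \<le> card {0..<int l}"
      using \<open>l > 2\<close> by (intro card_mono) (auto simp: f_def g_def)
    moreover have "2 * card S = l + 1"
    proof -
      obtain j where "l = 2 * j + 1" using \<open>odd l\<close> oddE by blast
      then show ?thesis by (simp add: S_def nat_add_distrib)
    qed
    ultimately show False by simp
  qed
  then obtain x y where "f x = g y" by auto
  then have "int l dvd x ^ 2 + b * y ^ 2 + c"
    by (simp add: f_def g_def mod_eq_dvd_iff algebra_simps)
  then show ?thesis by blast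
qed

section \<open>Isotropy of the forms at each place\<close>

text \<open>
  A zero \<open>(x, y, 1)\<close> modulo \<open>l\<close> lifts in the first coordinate unless \<open>l\<close> divides \<open>x\<close>. In
  that case \<open>- b * c\<close> is a nonzero square modulo \<open>l\<close>, namely of \<open>b * y\<close>; if \<open>w\<close> is its
  \<open>l\<close>-adic square root, then \<open>(0, w, b)\<close> is a zero, because
  \<open>b * w ^ 2 + c * b ^ 2 = b * (w ^ 2 + b * c)\<close>.
\<close>
lemma isotropic_at_odd_good_prime:
  assumes l: "prime l" "l \<noteq> 2" and b: "\<not> l dvd b" and c: "\<not> l dvd c"
  shows "isotropic_at (Fin_place l) \<langle>1, b, c\<rangle>"
proof -
  have b': "\<not> int l dvd int b" and c': "\<not> int l dvd int c" using b c by auto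
  have pl: "prime (int l)" using l by simp
  obtain x y where xy: "int l dvd x ^ 2 + int b * y ^ 2 + int c"
    using exists_zero_mod_odd_prime[OF l b'] by blast
  show ?thesis
  proof (cases "int l dvd x")
    case False
    define A where "A = - (int b * y ^ 2 + int c)"
    have A: "int l dvd x ^ 2 - A" using xy by (simp add: A_def algebra_simps)
    have "\<not> int l dvd A"
    proof
      assume "int l dvd A"
      with A have "int l dvd x ^ 2 - A + A" by (rule dvd_add)
      then show False using False pl by (simp add: prime_dvd_power_iff)
    qed
    then obtain u where u: "\<And>n. int l ^ n dvd u (Suc n) - u n" "\<And>n. int l ^ n dvd u n ^ 2 - A"
      using square_root_lift_odd[OF l A] by metis
    show ?thesis
      by (rule isotropic_at_Fin_placeI[OF l(1), of u "\<lambda>_. y" _ _ _ 1])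
         (use u in \<open>simp_all add: A_def algebra_simps\<close>)
  next
    case True
    define A where "A = - (int b * int c)"
    have "int l dvd (x ^ 2 + int b * y ^ 2 + int c) - x * x" using xy True by (intro dvd_diff) auto
    then have "int l dvd int b * (int b * y ^ 2 + int c)" by (simp add: power2_eq_square)
    then have A: "int l dvd (int b * y) ^ 2 - A"
      by (simp add: A_def power2_eq_square algebra_simps)
    have "\<not> int l dvd A" using pl b' c' by (simp add: A_def prime_dvd_mult_iff)
    then obtain u where u: "\<And>n. int l ^ n dvd u (Suc n) - u n" "\<And>n. int l ^ n dvd u n ^ 2 - A"
      using square_root_lift_odd[OF l A] by metis
    have "b \<noteq> 0" using b by (auto intro: Nat.gr0I)
    moreover have "int l ^ n dvd int b * (u n ^ 2 - A)" for n using u(2) by simp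
    ultimately show ?thesis
      using u(1) \<open>b \<noteq> 0\<close>
      by (intro isotropic_at_Fin_placeI[OF l(1), of "\<lambda>_. 0" u _ _ _ "int b"])
         (auto simp: A_def power2_eq_square algebra_simps)
  qed
qed

text \<open>
  The \<open>l\<close>-adic square root \<open>w\<close> of \<open>- c\<close> gives the zero \<open>(w, 0, 1)\<close>.
\<close>
lemma isotropic_at_odd_prime_if_QuadRes:
  assumes l: "prime l" "l \<noteq> 2" and c: "\<not> l dvd c" "QuadRes (int l) (- int c)"
  shows "isotropic_at (Fin_place l) \<langle>1, b, c\<rangle>"
proof -
  obtain x where x: "int l dvd x ^ 2 - (- int c)"
    using c(2) by (auto simp: QuadRes_def cong_iff_dvd_diff)
  have "\<not> int l dvd - int c" using c(1) by simp
  then obtain u where u: "\<And>n. int l ^ n dvd u (Suc n) - u n" "\<And>n. int l ^ n dvd u n ^ 2 - (- int c)"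
    using square_root_lift_odd[OF l x] by metis
  show ?thesis
    by (rule isotropic_at_Fin_placeI[OF l(1), of u "\<lambda>_. 0" _ _ _ 1]) (use u in simp_all)
qed

text \<open>
  If \<open>a\<close> is 7 modulo 8, then \<open>- a\<close> is already 1 modulo 8 and \<open>t\<close> may be any multiple of 4;
  if \<open>a\<close> is 3 modulo 8, then \<open>t = 2\<close> contributes the missing \<open>4 * b\<close>, which is 4 modulo 8.
  Nonzero \<open>t\<close> is wanted because it becomes the constant coordinate of a zero.
\<close>
lemma exists_unit_square_mod_8:
  fixes a b :: int
  assumes "a mod 4 = 3" "odd b"
  shows "\<exists>t. t \<noteq> 0 \<and> 8 dvd 1 - (- (a + b * t ^ 2))"
proof -
  obtain i where i: "a = 4 * i + 3" using assms(1) by (metis div_mult_mod_eq mult.commute)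
  obtain j where j: "b = 2 * j + 1" using assms(2) oddE by blast
  show ?thesis
  proof (cases "even i")
    case True
    then obtain k where "i = 2 * k" by blast
    then show ?thesis by (intro exI[of _ 2] conjI dvdI[of _ _ "k + j + 1"]) (simp_all add: i j)
  next
    case False
    then obtain k where "i = 2 * k + 1" by (rule oddE)
    then show ?thesis by (intro exI[of _ 4] conjI dvdI[of _ _ "k + 1 + 2 * b"]) (simp_all add: i)
  qed
qed

lemma isotropic_at_2_if_middle_3_mod_4:
  assumes "b mod 4 = 3" "odd c"
  shows "isotropic_at (Fin_place 2) \<langle>1, b, c\<rangle>"
proof -
  have "int b mod 4 = 3" "odd (int c)" using assms by presburger+
  then obtain t where t: "t \<noteq> 0" "8 dvd 1 - (- (int b + int c * t ^ 2))"
    using exists_unit_square_mod_8 by blast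
  obtain u where u: "\<And>n. int 2 ^ n dvd u (Suc n) - u n" "\<And>n. int 2 ^ n dvd u n ^ 2 - (- (int b + int c * t ^ 2))"
    using square_root_lift_2[OF t(2)] by metis
  show ?thesis
    by (rule isotropic_at_Fin_placeI[OF two_is_prime_nat, of u "\<lambda>_. 1" _ _ _ t])
       (use u t in \<open>simp_all add: algebra_simps\<close>)
qed

lemma isotropic_at_2_if_last_3_mod_4:
  assumes "odd b" "c mod 4 = 3"
  shows "isotropic_at (Fin_place 2) \<langle>1, b, c\<rangle>"
proof -
  have "int c mod 4 = 3" "odd (int b)" using assms by presburger+
  then obtain t where t: "8 dvd 1 - (- (int c + int b * t ^ 2))"
    using exists_unit_square_mod_8 by blast
  obtain u where u: "\<And>n. int 2 ^ n dvd u (Suc n) - u n" "\<And>n. int 2 ^ n dvd u n ^ 2 - (- (int c + int b * t ^ 2))"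
    using square_root_lift_2[OF t] by metis
  show ?thesis
    by (rule isotropic_at_Fin_placeI[OF two_is_prime_nat, of u "\<lambda>_. t" _ _ _ 1])
       (use u in \<open>simp_all add: algebra_simps\<close>)
qed

text \<open>
  Descent modulo \<open>p ^ 2\<close>: since \<open>- q\<close> is a nonresidue, \<open>p\<close> divides \<open>x\<close> and \<open>y\<close>, so \<open>p ^ 2\<close>
  divides \<open>p * z ^ 2\<close> and \<open>p\<close> divides \<open>z\<close> too.
\<close>
lemma anisotropic_at_prime_coefficient:
  assumes p: "prime p" and q: "Legendre (- int q) (int p) = -1"
  shows "anisotropic_at (Fin_place p) \<langle>1, q, p\<rangle>"
proof
  assume "isotropic_at (Fin_place p) \<langle>1, q, p\<rangle>"
  then obtain x y z :: int where prim: "\<not> (int p dvd x \<and> int p dvd y \<and> int p dvd z)"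
    and F: "int p ^ 2 dvd int 1 * x ^ 2 + int q * y ^ 2 + int p * z ^ 2"
    using isotropic_at_Fin_place_imp_primitive_zero[OF p, of 1 q p 2] by metis
  have pl: "prime (int p)" using p by simp
  have F1: "int p dvd x ^ 2 + int q * y ^ 2 + int p * z ^ 2"
  proof -
    have "int p dvd int p ^ 2" by (simp add: power2_eq_square)
    from dvd_trans[OF this F] show ?thesis by simp
  qed
  have xy: "int p dvd x ^ 2 + int q * y ^ 2"
    using dvd_diff[OF F1, of "int p * z ^ 2"] by simp
  have y: "int p dvd y"
  proof (rule ccontr)
    assume "\<not> int p dvd y"
    then have "coprime (int p) y" using pl by (intro prime_imp_coprime)
    then have "coprime y (int p)" by (rule coprime_commute[THEN iffD1])
    then obtain w where w: "[y * w = 1] (mod int p)" using cong_solve_coprime_int by blast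
    have "[x ^ 2 = - int q * y ^ 2] (mod int p)" using xy by (simp add: cong_iff_dvd_diff)
    from cong_scalar_right[OF this, of "w ^ 2"]
    have "[(x * w) ^ 2 = - int q * (y * w) ^ 2] (mod int p)"
      by (simp add: power_mult_distrib algebra_simps)
    also have "[- int q * (y * w) ^ 2 = - int q * 1 ^ 2] (mod int p)"
      by (intro cong_mult cong_pow w cong_refl)
    finally have "QuadRes (int p) (- int q)" by (auto simp: QuadRes_def)
    with q show False by (auto simp: Legendre_def split: if_splits)
  qed
  have "int p dvd x ^ 2 + int q * y ^ 2 - int q * y ^ 2"
    using xy y by (intro dvd_diff) (auto simp: power2_eq_square)
  then have x: "int p dvd x" using pl by (simp add: prime_dvd_power_iff)
  have "int p ^ 2 dvd x ^ 2 + int q * y ^ 2"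
    using x y by (intro dvd_add dvd_mult dvd_power_same)
  from dvd_diff[OF F this] have "int p ^ 2 dvd int p * z ^ 2" by simp
  then have "int p * int p dvd int p * z ^ 2" by (simp add: power2_eq_square)
  then have "int p dvd z" using pl p by (simp add: prime_dvd_power_iff)
  with x y prim show False by blast
qed

text \<open>
  Squares are 0, 1 or 4 modulo 8, which forces all three coordinates of a zero modulo 8 to
  be even.
\<close>
lemma anisotropic_at_2: "anisotropic_at (Fin_place 2) \<langle>1, 1, 2\<rangle>"
proof
  assume "isotropic_at (Fin_place 2) \<langle>1, 1, 2\<rangle>"
  then obtain x y z :: int where prim: "\<not> (int 2 dvd x \<and> int 2 dvd y \<and> int 2 dvd z)"
    and F: "int 2 ^ 3 dvd int 1 * x ^ 2 + int 1 * y ^ 2 + int 2 * z ^ 2"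
    using isotropic_at_Fin_place_imp_primitive_zero[OF two_is_prime_nat, of 1 1 2 3] by metis
  have sq: "odd n \<and> n ^ 2 mod 8 = 1 \<or> even n \<and> (n ^ 2 mod 8 = 0 \<or> n ^ 2 mod 8 = 4)" for n :: int
  proof -
    have "n mod 8 = 0 \<or> n mod 8 = 1 \<or> n mod 8 = 2 \<or> n mod 8 = 3 \<or>
        n mod 8 = 4 \<or> n mod 8 = 5 \<or> n mod 8 = 6 \<or> n mod 8 = 7" by presburger
    moreover have "even n \<longleftrightarrow> even (n mod 8)" by presburger
    moreover have "n ^ 2 mod 8 = (n mod 8) ^ 2 mod 8" by (simp add: power_mod)
    ultimately show ?thesis by (elim disjE) simp_all
  qed
  define r s t where "r = x ^ 2" and "s = y ^ 2" and "t = z ^ 2"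
  have "(r + s + 2 * t) mod 8 = 0" using F by (simp add: r_def s_def t_def)
  moreover have "(r + s + 2 * t) mod 8 = (r mod 8 + s mod 8 + 2 * (t mod 8)) mod 8"
    unfolding cong_def[symmetric] by (intro cong_add cong_mult cong_refl) (simp_all add: cong_def)
  ultimately show False
    using prim sq[of x, folded r_def] sq[of y, folded s_def] sq[of z, folded t_def]
    by (elim disjE conjE) simp_all
qed

section \<open>Forms ramified at one prime and infinity\<close>

lemma anisotropic_precisely_at_p_and_infinity:
  assumes p: "prime p" "p \<noteq> 2" and q: "q > 0" "Legendre (- int q) (int p) = -1"
    and bad: "\<And>l. prime l \<Longrightarrow> l \<noteq> 2 \<Longrightarrow> l dvd q \<Longrightarrow> QuadRes (int l) (- int p)"
    and two: "isotropic_at (Fin_place 2) \<langle>1, q, p\<rangle>"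
  shows "anisotropic_precisely_at \<langle>1, q, p\<rangle> {Fin_place p, Inf_place}"
  unfolding anisotropic_precisely_at_def
proof
  fix v assume "v \<in> places"
  then consider "v = Inf_place" | "v = Fin_place p" | l where "v = Fin_place l" "prime l" "l \<noteq> p"
    by (auto simp: places_def)
  then show "anisotropic_at v \<langle>1, q, p\<rangle> \<longleftrightarrow> v \<in> {Fin_place p, Inf_place}"
  proof cases
    case 1
    then show ?thesis using anisotropic_at_Inf_place[of 1 q p] q p prime_gt_0_nat by auto
  next
    case 2
    then show ?thesis using anisotropic_at_prime_coefficient[OF p(1) q(2)] by simp
  next
    case 3
    have "\<not> l dvd p" using 3 p by (auto simp: primes_dvd_imp_eq)
    then have "isotropic_at (Fin_place l) \<langle>1, q, p\<rangle>"
      using 3 two isotropic_at_odd_good_prime[of l q p] isotropic_at_odd_prime_if_QuadRes[of l p q] bad[of l]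
      by blast
    with 3 show ?thesis by simp
  qed
qed

lemma anisotropic_precisely_1_1_2:
  "anisotropic_precisely_at \<langle>1, 1, 2\<rangle> {Fin_place 2, Inf_place}"
  unfolding anisotropic_precisely_at_def
proof
  fix v assume "v \<in> places"
  then consider "v = Inf_place" | "v = Fin_place 2" | l where "v = Fin_place l" "prime l" "l \<noteq> 2"
    by (auto simp: places_def)
  then show "anisotropic_at v \<langle>1, 1, 2\<rangle> \<longleftrightarrow> v \<in> {Fin_place 2, Inf_place}"
  proof cases
    case 1
    then show ?thesis using anisotropic_at_Inf_place[of 1 1 2] by auto
  next
    case 2
    then show ?thesis using anisotropic_at_2 by simp
  next
    case 3
    have "\<not> l dvd 2" "\<not> l dvd 1" using 3 by (auto simp: primes_dvd_imp_eq)
    then show ?thesis using 3 isotropic_at_odd_good_prime[of l 1 2] by simp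
  qed
qed

theorem proposition4:
  fixes p :: nat
  assumes "prime p"
  shows "\<exists>q. (q = 1 \<or> (prime q \<and> q \<noteq> p)) \<and>
             anisotropic_precisely_at \<langle>1, q, p\<rangle> {Fin_place p, Inf_place}"
proof -
  note p = assms
  consider "p = 2" | "p > 2" "p mod 4 = 3" | "p > 2" "p mod 4 = 1"
  proof (cases "p = 2")
    case False
    then have "p > 2" using prime_ge_2_nat[OF p] by simp
    then have "odd p" using p prime_odd_nat by blast
    then have "p mod 4 = 1 \<or> p mod 4 = 3" by presburger
    then show thesis using that \<open>p > 2\<close> by blast
  qed
  then show ?thesis
  proof cases
    case 1
    then show ?thesis using anisotropic_precisely_1_1_2 by blast
  next
    case 2
    have "anisotropic_precisely_at \<langle>1, 1, p\<rangle> {Fin_place p, Inf_place}"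
    proof (rule anisotropic_precisely_at_p_and_infinity[OF p])
      show "Legendre (- int 1) (int p) = - 1"
        using Legendre_minus_one[OF p 2(1)] 2(2) by simp
      show "isotropic_at (Fin_place 2) \<langle>1, 1, p\<rangle>"
        using 2(2) by (intro isotropic_at_2_if_last_3_mod_4) auto
    qed (use 2 in auto)
    then show ?thesis by blast
  next
    case 3
    obtain q where q: "prime q" "q mod 4 = 3" "Legendre (int q) (int p) = - 1"
      using exists_prime_3_mod_4_nonresidue[OF p 3(2)] by blast
    have "q \<noteq> p" using q(2) 3(2) by auto
    have "q > 2" using q(2) prime_ge_2_nat[OF q(1)] by (cases "q = 2") auto
    have "odd p" using 3 p prime_odd_nat by blast
    have "even ((p - 1) div 2)" using 3(2) by presburger
    then have "Legendre (int p) (int q) * Legendre (int q) (int p) = 1"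
      using Quadratic_Reciprocity[OF p 3(1) q(1) \<open>q > 2\<close>] \<open>q \<noteq> p\<close> by simp
    then have "Legendre (int p) (int q) = - 1" using q(3) by simp
    then have "Legendre (- int p) (int q) = 1"
      using Legendre_mult[OF q(1) \<open>q > 2\<close>, of "- 1" "int p"] Legendre_minus_one[OF q(1) \<open>q > 2\<close>] q(2)
      by simp
    then have res: "QuadRes (int q) (- int p)" by (auto simp: Legendre_def split: if_splits)
    have "anisotropic_precisely_at \<langle>1, q, p\<rangle> {Fin_place p, Inf_place}"
    proof (rule anisotropic_precisely_at_p_and_infinity[OF p])
      show "Legendre (- int q) (int p) = - 1"
        using Legendre_mult[OF p 3(1), of "- 1" "int q"] Legendre_minus_one[OF p 3(1)] 3(2) q(3) by simp
      show "isotropic_at (Fin_place 2) \<langle>1, q, p\<rangle>"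
        using q(2) \<open>odd p\<close> by (rule isotropic_at_2_if_middle_3_mod_4)
      show "QuadRes (int l) (- int p)" if "prime l" "l dvd q" for l
        using that q(1) res primes_dvd_imp_eq by blast
    qed (use 3 q prime_gt_0_nat in auto)
    then show ?thesis using q(1) \<open>q \<noteq> p\<close> by blast
  qed
qed

end
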